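(* Let $G$ be an Abelian topological group and let $\pi:X\to Y$ be a tame extension of minimal $G$-systems. Consider the conditions: (1) $\pi$ is highly proximal; (2) $\pi$ is proximal; (3) every equicontinuous factor of $(X,G)$ factors through $\pi$. Then (1)$\Rightarrow$(2)$\Leftrightarrow$(3). Moreover, if $X$ is metrizable, or if $\pi$ is open and $Y$ is metrizable, then conditions (1), (2), (3) are all equivalent.
   Context: A $G$-system $(X,G)$ is a compact Hausdorff space $X$ with a continuous action of $G$; it is minimal if every orbit is dense. An extension (factor map) $\pi:X\to Y$ is a continuous surjective $G$-equivariant map. Let $R_\pi=\{(x_1,x_2)\in X^2:\pi(x_1)=\pi(x_2)\}$ and $\Delta_2(X)=\{(x,x)\}$. For subsets $A_1,A_2\subseteq X$, $J\subseteq G$ is an independence set if for every nonempty finite $I\subseteq J$ and $\sigma:I\to\{1,2\}$, $\bigcap_{s\in I}s^{-1}A_{\sigma(s)}\neq\emptyset$; ${\rm IT}_2(X,G)$ is the set of pairs $(x,y)$ such that for all neighbourhoods $U\ni x$, $V\ni y$, $(U,V)$ has an infinite independence set. $\pi$ is tame if $({\rm IT}_2(X,G)\cap R_\pi)\setminus\Delta_2(X)=\emptyset$. $\pi$ is proximal if every pair $(x_1,x_2)\in R_\pi$ is proximal, i.e., the orbit closure $\overline{G(x_1,x_2)}$ meets $\Delta_2(X)$. $\pi$ is highly proximal if for every nonempty open $U\subseteq X$ and every $z\in Y$ there exists $s\in G$ with $\pi^{-1}(z)\subseteq sU$. A system $(W,G)$ is equicontinuous if the family of maps $w\mapsto sw$,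 $s\in G$, is equicontinuous with respect to the unique uniformity of $W$. Condition (3) means: for every extension $\theta:X\to W$ with $(W,G)$ equicontinuous there is an extension $\theta':Y\to W$ with $\theta=\theta'\circ\pi$. *)

theory Defs
  imports "HOL-Analysis.Analysis"
begin

definition G_system :: "'a topology \<Rightarrow> ('g::topological_ab_group_add \<Rightarrow> 'a \<Rightarrow> 'a) \<Rightarrow> bool" where
  "G_system X act \<longleftrightarrow> compact_space X \<and> Hausdorff_space X \<and>
     continuous_map (prod_topology euclidean X) X (\<lambda>(g, x). act g x) \<and>
     (\<forall>x\<in>topspace X. act 0 x = x) \<and>
     (\<forall>g h. \<forall>x\<in>topspace X. act (g + h) x = act g (act h x))"

definition minimal_system :: "'a topology \<Rightarrow> ('g::topological_ab_group_add \<Rightarrow> 'a \<Rightarrow> 'a) \<Rightarrow> bool" where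
  "minimal_system X act \<longleftrightarrow> G_system X act \<and>
     (\<forall>x\<in>topspace X. X closure_of (range (\<lambda>s. act s x)) = topspace X)"

definition extension :: "'a topology \<Rightarrow> ('g::topological_ab_group_add \<Rightarrow> 'a \<Rightarrow> 'a) \<Rightarrow>
    'b topology \<Rightarrow> ('g \<Rightarrow> 'b \<Rightarrow> 'b) \<Rightarrow> ('a \<Rightarrow> 'b) \<Rightarrow> bool" where
  "extension X actX Y actY \<pi> \<longleftrightarrow> continuous_map X Y \<pi> \<and> \<pi> ` topspace X = topspace Y \<and>
     (\<forall>s. \<forall>x\<in>topspace X. \<pi> (actX s x) = actY s (\<pi> x))"

definition indep_set :: "'a topology \<Rightarrow> ('g \<Rightarrow> 'a \<Rightarrow> 'a) \<Rightarrow> 'a set \<Rightarrow> 'a set \<Rightarrow> 'g set \<Rightarrow> bool" where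
  "indep_set X act A1 A2 J \<longleftrightarrow>
     (\<forall>I (\<sigma>::'g \<Rightarrow> bool). finite I \<and> I \<noteq> {} \<and> I \<subseteq> J \<longrightarrow>
        (\<Inter>s\<in>I. {x \<in> topspace X. act s x \<in> (if \<sigma> s then A1 else A2)}) \<noteq> {})"

definition IT2 :: "'a topology \<Rightarrow> ('g \<Rightarrow> 'a \<Rightarrow> 'a) \<Rightarrow> ('a \<times> 'a) set" where
  "IT2 X act = {(x, y). x \<in> topspace X \<and> y \<in> topspace X \<and>
     (\<forall>U V. openin X U \<and> x \<in> U \<and> openin X V \<and> y \<in> V \<longrightarrow>
        (\<exists>J. infinite J \<and> indep_set X act U V J))}"

definition R_rel :: "'a topology \<Rightarrow> ('a \<Rightarrow> 'b) \<Rightarrow> ('a \<times> 'a) set" where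
  "R_rel X \<pi> = {(x1, x2). x1 \<in> topspace X \<and> x2 \<in> topspace X \<and> \<pi> x1 = \<pi> x2}"

definition Delta2 :: "'a topology \<Rightarrow> ('a \<times> 'a) set" where
  "Delta2 X = {(x, x) | x. x \<in> topspace X}"

definition tame_ext :: "'a topology \<Rightarrow> ('g \<Rightarrow> 'a \<Rightarrow> 'a) \<Rightarrow> ('a \<Rightarrow> 'b) \<Rightarrow> bool" where
  "tame_ext X act \<pi> \<longleftrightarrow> (IT2 X act \<inter> R_rel X \<pi>) - Delta2 X = {}"

definition proximal_pair :: "'a topology \<Rightarrow> ('g \<Rightarrow> 'a \<Rightarrow> 'a) \<Rightarrow> 'a \<Rightarrow> 'a \<Rightarrow> bool" where
  "proximal_pair X act x1 x2 \<longleftrightarrow>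
     (prod_topology X X) closure_of (range (\<lambda>s. (act s x1, act s x2))) \<inter> Delta2 X \<noteq> {}"

definition proximal_ext :: "'a topology \<Rightarrow> ('g \<Rightarrow> 'a \<Rightarrow> 'a) \<Rightarrow> ('a \<Rightarrow> 'b) \<Rightarrow> bool" where
  "proximal_ext X act \<pi> \<longleftrightarrow> (\<forall>(x1, x2) \<in> R_rel X \<pi>. proximal_pair X act x1 x2)"

definition highly_proximal_ext :: "'a topology \<Rightarrow> ('g \<Rightarrow> 'a \<Rightarrow> 'a) \<Rightarrow> 'b topology \<Rightarrow> ('a \<Rightarrow> 'b) \<Rightarrow> bool" where
  "highly_proximal_ext X act Y \<pi> \<longleftrightarrow>
     (\<forall>U z. openin X U \<and> U \<noteq> {} \<and> z \<in> topspace Y \<longrightarrow>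
        (\<exists>s. {x \<in> topspace X. \<pi> x = z} \<subseteq> act s ` U))"

text \<open>Equicontinuity w.r.t. the unique uniformity of a compact Hausdorff space,
  whose entourages are exactly the neighbourhoods of the diagonal in W x W.\<close>
definition equicontinuous_system :: "'w topology \<Rightarrow> ('g \<Rightarrow> 'w \<Rightarrow> 'w) \<Rightarrow> bool" where
  "equicontinuous_system W act \<longleftrightarrow>
     (\<forall>E. openin (prod_topology W W) E \<and> Delta2 W \<subseteq> E \<longrightarrow>
        (\<exists>D. openin (prod_topology W W) D \<and> Delta2 W \<subseteq> D \<and>
           (\<forall>s. \<forall>(w1, w2) \<in> D. (act s w1, act s w2) \<in> E)))"

definition eqc_factors_through ::
  "'w itself \<Rightarrow> 'a topology \<Rightarrow> ('g::topological_ab_group_add \<Rightarrow> 'a \<Rightarrow> 'a) \<Rightarrow>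
    'b topology \<Rightarrow> ('g \<Rightarrow> 'b \<Rightarrow> 'b) \<Rightarrow> ('a \<Rightarrow> 'b) \<Rightarrow> bool" where
  "eqc_factors_through (_::'w itself) X actX Y actY \<pi> \<longleftrightarrow>
     (\<forall>(W::'w topology) actW \<theta>. G_system W actW \<and> equicontinuous_system W actW \<and>
        extension X actX W actW \<theta> \<longrightarrow>
        (\<exists>\<theta>'. extension Y actY W actW \<theta>' \<and> (\<forall>x\<in>topspace X. \<theta> x = \<theta>' (\<pi> x))))"

end

theory Submission
  imports Defs
begin

text \<open>
  The conditions are linked in a cycle, (1) to (2) to (3) to (1); only the last step is hard.

  Let \<open>L\<close> be an invariant finitely additive probability on the subsets of \<open>G\<close>, which exists since
  \<open>G\<close> is Abelian. For \<open>Q \<subseteq> X\<close> put \<open>B(U) = {g. gU meets Q}\<close> and let \<open>k(x, y)\<close> be the infimum of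
  \<open>L (B(U) \<inter> B(V))\<close> over neighbourhoods \<open>U\<close> of \<open>x\<close> and \<open>V\<close> of \<open>y\<close>. By minimality \<open>k(x, x)\<close> is constant,
  which makes \<open>k\<close> continuous (a finitely additive form of McMahon's argument on invariant closed
  relations); so \<open>sup\<^sub>z |k(x, z) - k(y, z)|\<close> is a continuous invariant pseudometric and its quotient is
  an equicontinuous factor. Condition (3) forces it to vanish on \<open>R\<^sub>\<pi>\<close>. With \<open>Q\<close> a union of translates
  of an open set \<open>U\<close>, this says that if \<open>W\<close> is open and meets a \<open>\<pi>\<close>-fibre which the closure of \<open>U\<close> also
  meets, then some \<open>r\<close> moves a point of \<open>U\<close> into \<open>W\<close> while returning any finitely many prescribed open
  sets to themselves. Iterating produces infinite independence sets for \<open>(U1, U2)\<close> whenever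
  \<open>\<pi> (cl U1) \<inter> \<pi> (cl U2)\<close> has interior. If \<open>\<pi>\<close> is not highly proximal, a proper closed subset of \<open>X\<close> maps
  onto \<open>Y\<close>, and compactness gives two distinct points all of whose neighbourhoods have this property:
  a nondiagonal IT-pair in \<open>R\<^sub>\<pi>\<close>, contradicting tameness.
\<close>

section \<open>Invariant means on Abelian groups\<close>

definition shift_set :: "'g::ab_group_add \<Rightarrow> 'g set \<Rightarrow> 'g set" where
  "shift_set g B = {h. g + h \<in> B}"

text \<open>Defined on all subsets of \<open>G\<close>, so hitting times never have to be checked
  for measurability.\<close>

definition prob_charge :: "('g set \<Rightarrow> real) \<Rightarrow> bool" where
  "prob_charge L \<longleftrightarrow> (\<forall>B. 0 \<le> L B) \<and> L UNIV = 1 \<and> (\<forall>A B. A \<inter> B = {} \<longrightarrow> L (A \<union> B) = L A + L B)"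

lemma shift_set_commute: "shift_set g (shift_set h B) = shift_set h (shift_set g B)"
  by (auto simp: shift_set_def algebra_simps)

lemma shift_set_Int: "shift_set g (A \<inter> B) = shift_set g A \<inter> shift_set g B"
  by (auto simp: shift_set_def)

lemma funpow_shift_set_commute:
  "((shift_set h) ^^ j) (shift_set g B) = shift_set g (((shift_set h) ^^ j) B)"
  by (induction j arbitrary: B) (auto simp: shift_set_commute)

lemma funpow_shift_set_Un: "((shift_set h) ^^ j) (A \<union> B) = ((shift_set h) ^^ j) A \<union> ((shift_set h) ^^ j) B"
  by (induction j) (auto simp: shift_set_def)

lemma funpow_shift_set_Int: "((shift_set h) ^^ j) (A \<inter> B) = ((shift_set h) ^^ j) A \<inter> ((shift_set h) ^^ j) B"
  by (induction j) (auto simp: shift_set_def)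

lemma funpow_shift_set_simps [simp]:
  "((shift_set h) ^^ j) UNIV = UNIV" "((shift_set h) ^^ j) {} = {}"
  by (induction j) (auto simp: shift_set_def)

lemma prob_charge_mono: "prob_charge L \<Longrightarrow> A \<subseteq> B \<Longrightarrow> L A \<le> L B"
  unfolding prob_charge_def
  by (metis Diff_disjoint Diff_partition le_add_same_cancel1)

lemma prob_charge_Diff: "prob_charge L \<Longrightarrow> A \<subseteq> B \<Longrightarrow> L (B - A) = L B - L A"
  unfolding prob_charge_def
  by (metis Diff_disjoint Diff_partition add_diff_cancel_left')

lemma prob_charge_le_1: "prob_charge L \<Longrightarrow> L A \<le> 1"
  using prob_charge_mono[of L A UNIV] by (auto simp: prob_charge_def)

lemma prob_charge_Un_le: 
  assumes "prob_charge L" shows "L (A \<union> B) \<le> L A + L B"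
proof -
  have "L (A \<union> (B - A)) = L A + L (B - A)"
    using assms unfolding prob_charge_def by (metis Diff_disjoint)
  then show ?thesis
    using prob_charge_mono[OF assms, of "B - A" B] by (simp add: Un_Diff_cancel)
qed

lemma prob_charge_UN_le:
  assumes "prob_charge L" "finite I" shows "L (\<Union>i\<in>I. A i) \<le> (\<Sum>i\<in>I. L (A i))"
  using assms(2)
proof induction
  case empty
  have "L ({} \<union> {}) = L {} + L {}" using assms(1) unfolding prob_charge_def by blast
  then show ?case by simp
next
  case (insert i I)
  then show ?case using prob_charge_Un_le[OF assms(1), of "A i" "\<Union>i\<in>I. A i"] by simp
qed

text \<open>Induction on \<open>F\<close>: averaging over \<open>n\<close> successive translates by
  a new element \<open>h\<close> makes the defect under \<open>h\<close> telescope to at most 1/n.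
  Translations commute, so the bounds for the earlier elements survive the averaging.\<close>

lemma almost_invariant_charge:
  fixes F :: "'g::ab_group_add set"
  assumes "finite F" "n > 0"
  shows "\<exists>L. prob_charge L \<and> (\<forall>g\<in>F. \<forall>B. \<bar>L (shift_set g B) - L B\<bar> \<le> 1 / real n)"
  using assms(1)
proof induction
  case empty
  \<comment> \<open>The induction starts from the point mass at 0.\<close>
  show ?case
    by (intro exI[of _ "\<lambda>B. if 0 \<in> B then 1 else 0"]) (auto simp: prob_charge_def)
next
  case (insert h F)
  then obtain L where L: "prob_charge L" and inv: "\<And>g B. g \<in> F \<Longrightarrow> \<bar>L (shift_set g B) - L B\<bar> \<le> 1 / real n"
    by auto
  define L' where "L' B = (\<Sum>j<n. L (((shift_set h) ^^ j) B)) / real n" for B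
  have "prob_charge L'"
    unfolding prob_charge_def
  proof (intro conjI allI impI)
    show "0 \<le> L' B" for B
      using L by (auto simp: L'_def prob_charge_def intro!: sum_nonneg divide_nonneg_nonneg)
    show "L' UNIV = 1" using L \<open>n > 0\<close> by (simp add: L'_def prob_charge_def)
    show "L' (A \<union> B) = L' A + L' B" if "A \<inter> B = {}" for A B
    proof -
      have "((shift_set h) ^^ j) A \<inter> ((shift_set h) ^^ j) B = {}" for j
        using that by (metis funpow_shift_set_Int funpow_shift_set_simps(2))
      then have "L (((shift_set h) ^^ j) (A \<union> B)) = L (((shift_set h) ^^ j) A) + L (((shift_set h) ^^ j) B)" for j
        using L by (simp add: prob_charge_def funpow_shift_set_Un)
      then show ?thesis by (simp add: L'_def sum.distrib add_divide_distrib)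
    qed
  qed
  moreover have "\<bar>L' (shift_set g B) - L' B\<bar> \<le> 1 / real n" if "g \<in> insert h F" for g B
  proof (cases "g = h")
    case True
    have "L' (shift_set h B) - L' B
        = ((\<Sum>j<n. L (((shift_set h) ^^ Suc j) B)) - (\<Sum>j<n. L (((shift_set h) ^^ j) B))) / real n"
      by (simp add: L'_def diff_divide_distrib funpow_shift_set_commute)
    also have "\<dots> = (L (((shift_set h) ^^ n) B) - L B) / real n"
      using sum_lessThan_telescope[of "\<lambda>j. L (((shift_set h) ^^ j) B)" n]
      by (simp add: sum_subtractf)
    also have "\<bar>\<dots>\<bar> \<le> 1 / real n"
    proof -
      have "0 \<le> L C" "L C \<le> 1" for C
        using prob_charge_le_1[OF L] L by (auto simp: prob_charge_def)
      then have "\<bar>L (((shift_set h) ^^ n) B) - L B\<bar> \<le> 1"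
        by (smt (verit))
      then show ?thesis by (simp add: abs_divide divide_right_mono)
    qed
    finally show ?thesis using True by simp
  next
    case False
    then have "g \<in> F" using that by simp
    have "\<bar>L' (shift_set g B) - L' B\<bar>
        = \<bar>\<Sum>j<n. L (shift_set g (((shift_set h) ^^ j) B)) - L (((shift_set h) ^^ j) B)\<bar> / real n"
      by (simp add: L'_def diff_divide_distrib[symmetric] funpow_shift_set_commute sum_subtractf)
    also have "\<dots> \<le> (\<Sum>j<n. \<bar>L (shift_set g (((shift_set h) ^^ j) B)) - L (((shift_set h) ^^ j) B)\<bar>) / real n"
      by (intro divide_right_mono sum_abs) auto
    also have "\<dots> \<le> (\<Sum>j<n. 1 / real n) / real n"
      using inv[OF \<open>g \<in> F\<close>] by (intro divide_right_mono sum_mono) auto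
    finally show ?thesis using \<open>n > 0\<close> by simp
  qed
  ultimately show ?case by blast
qed

text \<open>Each condition constrains finitely many values of \<open>L\<close>, hence is closed for
  pointwise convergence, the topology of the function type.\<close>

lemma closed_almost_invariant_charges:
  "closed {L :: 'g::ab_group_add set \<Rightarrow> real. prob_charge L \<and> (\<forall>B. \<bar>L (shift_set g B) - L B\<bar> \<le> e)}"
proof -
  have *: "continuous_on UNIV (\<lambda>L :: 'g set \<Rightarrow> real. L B)" for B
    by (rule continuous_on_product_coordinates)
  have "{L :: 'g set \<Rightarrow> real. prob_charge L \<and> (\<forall>B. \<bar>L (shift_set g B) - L B\<bar> \<le> e)}
     = (\<Inter>B. {L. 0 \<le> L B}) \<inter> {L. L UNIV = 1} \<inter> (\<Inter>(A, B)\<in>{(A, B). A \<inter> B = {}}. {L. L (A \<union> B) = L A + L B})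
       \<inter> (\<Inter>B. {L. \<bar>L (shift_set g B) - L B\<bar> \<le> e})"
    by (auto simp: prob_charge_def)
  moreover have "closed \<dots>"
    by (intro closed_Int closed_INT ballI; (clarsimp)?;
        intro closed_Collect_le closed_Collect_eq continuous_intros *)
  ultimately show ?thesis by simp
qed

text \<open>Compactness of the cube \<open>K\<close> (Tychonoff): the closed sets
  \<open>C (g, n)\<close> of charges invariant under \<open>g\<close> up to 1/(n+1) have the finite
  intersection property by \<open>almost_invariant_charge\<close>.\<close>

lemma ex_invariant_charge:
  "\<exists>L :: 'g::ab_group_add set \<Rightarrow> real. prob_charge L \<and> (\<forall>g B. L (shift_set g B) = L B)"
proof -
  define K :: "('g set \<Rightarrow> real) set" where "K = PiE UNIV (\<lambda>_. {0..1})"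
  define C where "C = (\<lambda>(g::'g, n). {L. prob_charge L \<and> (\<forall>B. \<bar>L (shift_set g B) - L B\<bar> \<le> 1 / real (Suc n))})"
  have "compactin (product_topology (\<lambda>i. euclidean) UNIV) K"
    unfolding K_def by (subst compactin_PiE) auto
  then have "compact K" by (simp add: euclidean_product_topology)
  then have "K \<inter> (\<Inter>i\<in>UNIV. C i) \<noteq> {}"
  proof (rule compact_imp_fip_image)
    show "closed (C i)" for i
      unfolding C_def by (cases i) (simp add: closed_almost_invariant_charges del: of_nat_Suc)
    fix I :: "('g \<times> nat) set" assume "finite I"
    \<comment> \<open>The strictest tolerance occurring in \<open>I\<close> serves all its pairs;
      inserting 0 covers empty \<open>I\<close>.\<close>
    define N where "N = Max (insert 0 (snd ` I))"
    obtain L where L: "prob_charge L"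
      "\<And>g B. g \<in> fst ` I \<Longrightarrow> \<bar>L (shift_set g B) - L B\<bar> \<le> 1 / real (Suc N)"
      using almost_invariant_charge[of "fst ` I" "Suc N"] \<open>finite I\<close> by blast
    have "L \<in> C (g, n)" if "(g, n) \<in> I" for g n
    proof -
      have "n \<le> N" using that \<open>finite I\<close> unfolding N_def by (intro Max_ge) force+
      then have "1 / real (Suc N) \<le> 1 / real (Suc n)" by (simp add: frac_le)
      moreover have "g \<in> fst ` I" using that by force
      ultimately show ?thesis using L unfolding C_def by (auto intro: order_trans)
    qed
    moreover have "L \<in> K"
      using L(1) prob_charge_le_1[OF L(1)] by (auto simp: K_def prob_charge_def)
    ultimately show "K \<inter> (\<Inter>i\<in>I. C i) \<noteq> {}" by fast
  qed
  then obtain L where L: "\<And>g n. L \<in> C (g, n)" by blast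
  have "L (shift_set g B) = L B" for g B
  proof (rule ccontr)
    assume "L (shift_set g B) \<noteq> L B"
    then obtain n where "1 / real (Suc n) < \<bar>L (shift_set g B) - L B\<bar>"
      using nat_approx_posE[of "\<bar>L (shift_set g B) - L B\<bar>"] by auto
    moreover have "\<bar>L (shift_set g B) - L B\<bar> \<le> 1 / real (Suc n)"
      using L[of g n] unfolding C_def by simp
    ultimately show False by simp
  qed
  then show ?thesis using L unfolding C_def by auto
qed

section \<open>Minimal systems\<close>

locale minimal_gsys =
  fixes X :: "'a topology" and act :: "'g::topological_ab_group_add \<Rightarrow> 'a \<Rightarrow> 'a"
  assumes minimal: "minimal_system X act"
begin

lemma compact: "compact_space X" and Hausdorff: "Hausdorff_space X"
  and act_0 [simp]: "x \<in> topspace X \<Longrightarrow> act 0 x = x"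
  and act_add: "x \<in> topspace X \<Longrightarrow> act (g + h) x = act g (act h x)"
  using minimal by (auto simp: minimal_system_def G_system_def)

lemma regular: "regular_space X"
  by (simp add: Hausdorff compact compact_Hausdorff_imp_regular_space)

lemma continuous_act2: "continuous_map (prod_topology euclidean X) X (\<lambda>(g, x). act g x)"
  using minimal by (auto simp: minimal_system_def G_system_def)

lemma continuous_act: "continuous_map X X (act g)"
proof -
  have "continuous_map X (prod_topology euclidean X) (\<lambda>x. (g, x))"
    by (intro continuous_intros) auto
  from continuous_map_compose[OF this continuous_act2] show ?thesis
    by (simp add: o_def)
qed

lemma act_in [simp]: "x \<in> topspace X \<Longrightarrow> act g x \<in> topspace X"
  using continuous_act[of g] by (auto simp: continuous_map_def)

lemma act_minus [simp]: "x \<in> topspace X \<Longrightarrow> act (- g) (act g x) = x"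
  "x \<in> topspace X \<Longrightarrow> act g (act (- g) x) = x"
  using act_add[of x "-g" g] act_add[of x g "-g"] by auto

definition pre :: "'g \<Rightarrow> 'a set \<Rightarrow> 'a set" where
  "pre g U = {x \<in> topspace X. act g x \<in> U}"

lemma openin_pre: "openin X U \<Longrightarrow> openin X (pre g U)"
  unfolding pre_def using continuous_act[of g] by (simp add: continuous_map_def)

lemma minimalD: 
  assumes "openin X U" "U \<noteq> {}" "x \<in> topspace X"
  shows "\<exists>g. act g x \<in> U"
proof -
  obtain u where u: "u \<in> U" "u \<in> topspace X" using assms openin_subset by blast
  have "u \<in> X closure_of (range (\<lambda>s. act s x))"
    using minimal assms(3) u by (auto simp: minimal_system_def)
  then show ?thesis using u assms by (auto simp: in_closure_of)
qed

text \<open>Every orbit visits \<open>U\<close>, so the sets \<open>pre g U\<close> cover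
  \<open>X\<close>, and compactness applies. This is the syndeticity of return times in a minimal
  system.\<close>

lemma finite_cover:
  assumes "openin X U" "U \<noteq> {}"
  shows "\<exists>F. finite F \<and> topspace X \<subseteq> (\<Union>g\<in>F. pre g U)"
proof -
  have "\<exists>\<F>. finite \<F> \<and> \<F> \<subseteq> range (\<lambda>g. pre g U) \<and> topspace X \<subseteq> \<Union>\<F>"
  proof (rule compactinD[of X])
    show "compactin X (topspace X)" using compact by (simp add: compact_space_def)
    show "topspace X \<subseteq> \<Union> (range (\<lambda>g. pre g U))"
      using minimalD[OF assms] by (auto simp: pre_def)
  qed (auto simp: openin_pre assms)
  then show ?thesis by (metis finite_subset_image)
qed

text \<open>Translating the visiting times to different sets lets them be met simultaneously
  with positive mean.\<close>

lemma simultaneous_visits: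
  assumes L: "prob_charge L"
    and "finite \<V>" and op: "\<And>V. V \<in> \<V> \<Longrightarrow> openin X V \<and> V \<noteq> {}" and "L B > 0"
    and "topspace X \<noteq> {}"
  shows "\<exists>e. (\<forall>V\<in>\<V>. e V \<in> topspace X) \<and> L (B \<inter> {g. \<forall>V\<in>\<V>. act g (e V) \<in> V}) > 0"
  using assms(2,3,4)
proof (induction arbitrary: B)
  case empty
  then show ?case by simp
next
  case (insert V \<V>)
  obtain x where x: "x \<in> topspace X" using assms by blast
  obtain F where F: "finite F" "topspace X \<subseteq> (\<Union>g\<in>F. pre g V)"
    using finite_cover[of V] insert.prems(1)[of V] by auto
  \<comment> \<open>An \<open>f\<close> from the finite cover sends \<open>act g x\<close> into
    \<open>V\<close>; by commutativity \<open>act g (act f x)\<close> lies in \<open>V\<close>.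
    Hence \<open>B\<close> is covered by finitely many sets \<open>A f\<close>, one of which has
    positive charge, and \<open>act f x\<close> becomes the point tracked for
    \<open>V\<close>.\<close>
  define A where "A f = B \<inter> {g. act g (act f x) \<in> V}" for f
  have "B \<subseteq> (\<Union>f\<in>F. A f)"
  proof
    fix g assume "g \<in> B"
    obtain f where "f \<in> F" "act f (act g x) \<in> V" using F(2) act_in[OF x, of g] by (auto simp: pre_def)
    then show "g \<in> (\<Union>f\<in>F. A f)" using \<open>g \<in> B\<close> x
      by (auto simp: A_def simp flip: act_add) (metis add.commute)
  qed
  then have "0 < (\<Sum>f\<in>F. L (A f))"
    using prob_charge_mono[OF L, of B "\<Union>f\<in>F. A f"] prob_charge_UN_le[OF L F(1), of A] insert.prems(2) by linarith
  then obtain f where f: "L (A f) > 0" by (metis not_less sum_nonpos)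
  then obtain e where e: "\<forall>V\<in>\<V>. e V \<in> topspace X" "L (A f \<inter> {g. \<forall>V\<in>\<V>. act g (e V) \<in> V}) > 0"
    using insert.IH[of "A f"] insert.prems by auto
  have "A f \<inter> {g. \<forall>V\<in>\<V>. act g (e V) \<in> V} = B \<inter> {g. \<forall>W\<in>insert V \<V>. act g ((e(V := act f x)) W) \<in> W}"
    using insert.hyps by (auto simp: A_def)
  then show ?case using e x by (intro exI[of _ "e(V := act f x)"]) auto
qed

section \<open>Equicontinuous factors from invariant pseudometrics\<close>

text \<open>The last clause, together with the triangle inequality, amounts to joint
  continuity.\<close>

definition invariant_pseudometric :: "('a \<Rightarrow> 'a \<Rightarrow> real) \<Rightarrow> bool" where
  "invariant_pseudometric d \<longleftrightarrow>
     (\<forall>x\<in>topspace X. \<forall>y\<in>topspace X. 0 \<le> d x y \<and> d x x = 0 \<and> d x y = d y x) \<and>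
     (\<forall>x\<in>topspace X. \<forall>y\<in>topspace X. \<forall>z\<in>topspace X. d x z \<le> d x y + d y z) \<and>
     (\<forall>g. \<forall>x\<in>topspace X. \<forall>y\<in>topspace X. d (act g x) (act g y) = d x y) \<and>
     (\<forall>x\<in>topspace X. \<forall>e>0. \<exists>U. openin X U \<and> x \<in> U \<and> (\<forall>y\<in>U. d x y < e))"

text \<open>Collapsing zero-distance classes yields a compact metric space on which \<open>G\<close>
  acts by isometries, hence an equicontinuous factor; by assumption it factors through \<pi>. Its
  points are subsets of \<open>X\<close>, which explains the type \<open>'a set\<close>.\<close>

lemma factors_through_imp_pseudometric_eq_0:
  fixes actY :: "'g \<Rightarrow> 'b \<Rightarrow> 'b"
  assumes eqc: "eqc_factors_through TYPE('a set) X act Y actY \<pi>"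
    and d: "invariant_pseudometric d"
    and x1: "x1 \<in> topspace X" and x2: "x2 \<in> topspace X" and "\<pi> x1 = \<pi> x2"
  shows "d x1 x2 = 0"
proof -
  have nonneg: "0 \<le> d x y" and refl: "d x x = 0" and sym: "d x y = d y x"
    and inv: "d (act g x) (act g y) = d x y"
    if "x \<in> topspace X" "y \<in> topspace X" for x y g
    using d that by (auto simp: invariant_pseudometric_def)
  have tri: "d x z \<le> d x y + d y z" if "x \<in> topspace X" "y \<in> topspace X" "z \<in> topspace X" for x y z
    using d that by (auto simp: invariant_pseudometric_def)
  have cont: "\<exists>U. openin X U \<and> x \<in> U \<and> (\<forall>y\<in>U. d x y < e)" if "x \<in> topspace X" "e > 0" for x e
    using d that by (auto simp: invariant_pseudometric_def)
  \<comment> \<open>Distance and action on classes are computed at the representatives chosen by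
    \<open>r\<close>. \<open>D\<close> is 0 off \<open>M\<close> because \<open>Metric_space\<close>
    demands nonnegativity and symmetry for all arguments.\<close>
  define q where "q x = {y \<in> topspace X. d x y = 0}" for x
  define M where "M = q ` topspace X"
  define r where "r C = (SOME x. x \<in> C)" for C :: "'a set"
  define D where "D C C' = (if C \<in> M \<and> C' \<in> M then d (r C) (r C') else 0)" for C C'
  define actW where "actW g C = q (act g (r C))" for g C
  have q_eq: "q x = q y \<longleftrightarrow> d x y = 0" if "x \<in> topspace X" "y \<in> topspace X" for x y
  proof
    assume "q x = q y"
    then have "y \<in> q x" using that refl by (auto simp: q_def)
    then show "d x y = 0" by (simp add: q_def)
  next
    assume "d x y = 0"
    then have "d x z = 0 \<longleftrightarrow> d y z = 0" if z: "z \<in> topspace X" for z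
      using tri[of x y z] tri[of y x z] nonneg[of x z] nonneg[of y z] sym[of x y] z
        \<open>x \<in> topspace X\<close> \<open>y \<in> topspace X\<close> by auto
    then show "q x = q y" by (auto simp: q_def)
  qed
  have M_E: "\<exists>x\<in>topspace X. C = q x" if "C \<in> M" for C using that by (auto simp: M_def)
  have qM: "q x \<in> M" if "x \<in> topspace X" for x using that by (simp add: M_def)
  have r: "r (q x) \<in> topspace X \<and> d x (r (q x)) = 0" if "x \<in> topspace X" for x
  proof -
    have "x \<in> q x" using that refl by (simp add: q_def)
    then have "r (q x) \<in> q x" unfolding r_def by (rule someI)
    then show ?thesis by (simp add: q_def)
  qed
  have D_q: "D (q x) (q y) = d x y" if "x \<in> topspace X" "y \<in> topspace X" for x y
  proof -
    note rr = r[OF that(1)] r[OF that(2)]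
    have "D (q x) (q y) = d (r (q x)) (r (q y))" using qM that by (simp add: D_def)
    moreover have "d (r (q x)) (r (q y)) \<le> d x y"
      using tri[of "r (q x)" x "r (q y)"] tri[of x y "r (q y)"] rr that sym[of x "r (q x)"] by auto
    moreover have "d x y \<le> d (r (q x)) (r (q y))"
      using tri[of x "r (q x)" y] tri[of "r (q x)" "r (q y)" y] rr that sym[of y "r (q y)"] by auto
    ultimately show ?thesis by simp
  qed
  have actW_q: "actW g (q x) = q (act g x)" if "x \<in> topspace X" for g x
    using r[OF that] that inv[of x "r (q x)" g] unfolding actW_def 
    by (subst q_eq) (auto simp: sym)
  interpret W: Metric_space M D
  proof
    show "0 \<le> D x y" for x y
      unfolding D_def using nonneg r by (auto simp: M_def)
    show "D x y = D y x" for x y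
      unfolding D_def using sym r by (auto simp: M_def)
    show "D x y = 0 \<longleftrightarrow> x = y" if "x \<in> M" "y \<in> M" for x y
      using that unfolding M_def by (elim imageE) (simp add: D_q q_eq)
    show "D x z \<le> D x y + D y z" if "x \<in> M" "y \<in> M" "z \<in> M" for x y z
      using that unfolding M_def by (auto simp: D_q tri)
  qed
  have q_cont: "continuous_map X W.mtopology q"
    unfolding W.continuous_map_to_metric
  proof (intro ballI allI impI)
    fix x and e :: real assume x: "x \<in> topspace X" and "0 < e"
    then obtain U where U: "openin X U" "x \<in> U" "\<And>y. y \<in> U \<Longrightarrow> d x y < e"
      using cont[OF x] by metis
    have "y \<in> topspace X" if "y \<in> U" for y using U(1) that openin_subset by blast
    then show "\<exists>U. openin X U \<and> x \<in> U \<and> (\<forall>y\<in>U. q y \<in> W.mball (q x) e)"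
      using U x by (intro exI[of _ U]) (auto simp: qM D_q)
  qed
  have M_image: "q ` topspace X = topspace W.mtopology" unfolding M_def[symmetric] by simp
  have compW: "compact_space W.mtopology"
    using image_compactin[OF _ q_cont, of "topspace X"] compact M_image
    by (simp add: compact_space_def)
  have D_inv: "D (actW g C) (actW g C') = D C C'" if "C \<in> M" "C' \<in> M" for g C C'
    using that[THEN M_E] by (auto simp: actW_q D_q inv)
  have actW_M: "actW g C \<in> M" if "C \<in> M" for g C
    using M_E[OF that] by (auto simp: actW_q qM)
  \<comment> \<open>\<open>act g x\<close> and \<open>act h y\<close> are compared through
    \<open>act h x\<close>: the first gap is small by continuity of the orbit map, the second
    because \<open>act h\<close> is isometric.\<close>
  have contW: "continuous_map (prod_topology euclidean W.mtopology) W.mtopology (\<lambda>(g, x). actW g x)"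
    unfolding W.continuous_map_to_metric
  proof (intro ballI allI impI)
    fix p and e :: real assume p: "p \<in> topspace (prod_topology (euclidean :: 'g topology) W.mtopology)" and "0 < e"
    then obtain g x where p: "p = (g, q x)" and x: "x \<in> topspace X"
      using M_E by (cases p) auto
    obtain U where U: "openin X U" "act g x \<in> U" "\<And>y. y \<in> U \<Longrightarrow> d (act g x) y < e / 2"
      using cont[of "act g x" "e / 2"] x \<open>0 < e\<close> by auto
    have "continuous_map euclidean (prod_topology euclidean X) (\<lambda>h. (h, x))"
      using x by (intro continuous_intros) auto
    from continuous_map_compose[OF this continuous_act2] 
    have "continuous_map euclidean X (\<lambda>h. act h x)" by (simp add: o_def)
    then have "openin euclidean {h \<in> topspace euclidean. act h x \<in> U}"
      using U(1) by (rule openin_continuous_map_preimage)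
    then have V: "openin euclidean {h. act h x \<in> U}" by simp
    have "D (actW g (q x)) (actW h C) < e" if h: "act h x \<in> U" and C: "C \<in> M" "D (q x) C < e / 2" for h C
    proof -
      obtain y where y: "C = q y" "y \<in> topspace X" using M_E[OF C(1)] by blast
      have "d (act g x) (act h y) \<le> d (act g x) (act h x) + d (act h x) (act h y)"
        using x y by (intro tri) auto
      also have "\<dots> < e / 2 + e / 2"
        using U(3)[OF h] C x y by (intro add_strict_mono) (auto simp: inv D_q)
      finally show ?thesis using x y by (simp add: actW_q D_q)
    qed
    then show "\<exists>U. openin (prod_topology (euclidean :: 'g topology) W.mtopology) U \<and> p \<in> U \<and>
        (\<forall>y\<in>U. (case y of (g, x) \<Rightarrow> actW g x) \<in> W.mball (case p of (g, x) \<Rightarrow> actW g x) e)"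
      using x U(2) V \<open>0 < e\<close>
      by (intro exI[of _ "{h. act h x \<in> U} \<times> W.mball (q x) (e / 2)"])
         (auto simp: p openin_prod_Times_iff W.openin_mball qM actW_M)
  qed
  have "G_system W.mtopology actW"
    unfolding G_system_def using compW W.Hausdorff_space_mtopology contW
    by (auto simp: actW_q act_add dest!: M_E)
  moreover have "equicontinuous_system W.mtopology actW"
    unfolding equicontinuous_system_def
  proof (intro allI impI, elim conjE)
    fix E assume E: "openin (prod_topology W.mtopology W.mtopology) E" "Delta2 W.mtopology \<subseteq> E"
    \<comment> \<open>A Lebesgue number argument follows: \<open>E\<close> contains all pairs at
      distance below some \<delta>. The doubled radius leaves room for a point within \<delta> of a
      point of the smaller ball.\<close>
    have "\<exists>e>0. \<forall>a b. a \<in> W.mball w (2 * e) \<and> b \<in> W.mball w (2 * e) \<longrightarrow> (a, b) \<in> E" if w: "w \<in> M" for w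
    proof -
      have "(w, w) \<in> E" using w E(2) by (auto simp: Delta2_def)
      then obtain U V where UV: "openin W.mtopology U" "openin W.mtopology V" "w \<in> U" "w \<in> V" "U \<times> V \<subseteq> E"
        using E(1) unfolding openin_prod_topology_alt by metis
      then have "openin W.mtopology (U \<inter> V)" "w \<in> U \<inter> V" by auto
      then obtain e where "e > 0" "W.mball w e \<subseteq> U \<inter> V"
        unfolding W.openin_mtopology by blast
      then have "(a, b) \<in> E" if "a \<in> W.mball w (2 * (e / 2))" "b \<in> W.mball w (2 * (e / 2))" for a b
        using UV(5) that by (auto simp del: W.in_mball)
      then show ?thesis using \<open>e > 0\<close> half_gt_zero by blast
    qed
    then obtain \<epsilon> where \<epsilon>: "\<And>w. w \<in> M \<Longrightarrow> \<epsilon> w > 0"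
      "\<And>w a b. w \<in> M \<Longrightarrow> a \<in> W.mball w (2 * \<epsilon> w) \<Longrightarrow> b \<in> W.mball w (2 * \<epsilon> w) \<Longrightarrow> (a, b) \<in> E"
      by metis
    obtain \<F> where \<F>: "finite \<F>" "\<F> \<subseteq> (\<lambda>w. W.mball w (\<epsilon> w)) ` M" "M \<subseteq> \<Union>\<F>"
      using compactinD[of W.mtopology M "(\<lambda>w. W.mball w (\<epsilon> w)) ` M"] compW \<epsilon>(1)
      by (auto simp: compact_space_def)
    obtain F where "F \<subseteq> M" "finite F" "\<F> = (\<lambda>w. W.mball w (\<epsilon> w)) ` F"
      using finite_subset_image[OF \<F>(1,2)] by blast
    then have F: "finite F" "F \<subseteq> M" "M \<subseteq> (\<Union>w\<in>F. W.mball w (\<epsilon> w))"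
      using \<F>(3) by auto
    \<comment> \<open>Inserting 1 keeps the minimum defined when \<open>F\<close> is empty.\<close>
    define \<delta> where "\<delta> = Min (insert 1 (\<epsilon> ` F))"
    have \<delta>: "\<delta> > 0" "\<And>w. w \<in> F \<Longrightarrow> \<delta> \<le> \<epsilon> w"
      using F \<epsilon>(1) by (auto simp: \<delta>_def)
    have near: "(a, b) \<in> E" if ab: "a \<in> M" "b \<in> M" "D a b < \<delta>" for a b
    proof -
      obtain w where w: "w \<in> F" "a \<in> W.mball w (\<epsilon> w)" using F ab by blast
      have "D w b < 2 * \<epsilon> w"
        using W.triangle[of w a b] w ab \<delta>(2)[OF w(1)] F(2) by auto
      moreover have "D w a < 2 * \<epsilon> w" using w \<epsilon>(1)[of w] F(2) by auto
      ultimately show ?thesis using \<epsilon>(2)[of w a b] w ab F(2) by auto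
    qed
    \<comment> \<open>The action preserves \<open>D\<close>, so this single neighbourhood of the
      diagonal serves all group elements at once.\<close>
    define N where "N = {(a, b). a \<in> M \<and> b \<in> M \<and> D a b < \<delta>}"
    have "openin (prod_topology W.mtopology W.mtopology) N"
      unfolding openin_prod_topology_alt
    proof (intro allI impI)
      fix a b assume "(a, b) \<in> N"
      then have ab: "a \<in> M" "b \<in> M" "D a b < \<delta>" by (auto simp: N_def)
      define s where "s = (\<delta> - D a b) / 2"
      have "(a', b') \<in> N" if "a' \<in> W.mball a s" "b' \<in> W.mball b s" for a' b'
        using that W.triangle[of a' a b'] W.triangle[of a b b'] W.commute[of a a'] ab
        by (auto simp: N_def s_def)
      then show "\<exists>U V. openin W.mtopology U \<and> openin W.mtopology V \<and> a \<in> U \<and> b \<in> V \<and> U \<times> V \<subseteq> N"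
        using ab by (intro exI[of _ "W.mball a s"] exI[of _ "W.mball b s"]) (auto simp: s_def)
    qed
    moreover have "Delta2 W.mtopology \<subseteq> N" using \<delta> by (auto simp: Delta2_def N_def)
    moreover have "\<forall>s. \<forall>(w1, w2)\<in>N. (actW s w1, actW s w2) \<in> E"
      by (auto simp: N_def actW_M D_inv intro!: near)
    ultimately show "\<exists>N. openin (prod_topology W.mtopology W.mtopology) N \<and> Delta2 W.mtopology \<subseteq> N \<and>
        (\<forall>s. \<forall>(w1, w2)\<in>N. (actW s w1, actW s w2) \<in> E)" by blast
  qed
  moreover have "extension X act W.mtopology actW q"
    using q_cont M_image by (auto simp: extension_def actW_q)
  ultimately obtain \<theta> where "\<forall>x\<in>topspace X. q x = \<theta> (\<pi> x)"
    using eqc[unfolded eqc_factors_through_def, rule_format, of W.mtopology actW q] by metis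
  then have "q x1 = q x2" using x1 x2 \<open>\<pi> x1 = \<pi> x2\<close> by simp
  then show ?thesis using q_eq x1 x2 by simp
qed

end

section \<open>The kernel of hitting times\<close>

locale charged_gsys = minimal_gsys X act
  for X :: "'a topology" and act :: "'g::topological_ab_group_add \<Rightarrow> 'a \<Rightarrow> 'a" +
  fixes L :: "'g set \<Rightarrow> real" and Q :: "'a set"
  assumes charge: "prob_charge L" and shift_invariant: "\<And>g B. L (shift_set g B) = L B"
begin

text \<open>The set B(U) of the introductory sketch. \<open>Q\<close> stays arbitrary until the
  proof of \<open>jump\<close> chooses it.\<close>

definition hit :: "'a set \<Rightarrow> 'g set" where
  "hit U = {g. \<exists>x\<in>U. act g x \<in> Q}"

definition nbhd :: "'a \<Rightarrow> 'a set set" where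
  "nbhd x = {U. openin X U \<and> x \<in> U}"

text \<open>Identified with the diagonal value \<open>k x x\<close> in \<open>k_diag\<close>, once
  its constancy is known.\<close>

definition m :: "'a \<Rightarrow> real" where
  "m x = (INF U\<in>nbhd x. L (hit U))"

definition k :: "'a \<Rightarrow> 'a \<Rightarrow> real" where
  "k x y = (INF p\<in>nbhd x \<times> nbhd y. L (hit (fst p) \<inter> hit (snd p)))"

lemma L_nonneg: "0 \<le> L B"
  using charge by (simp add: prob_charge_def)

lemma hit_mono: "U \<subseteq> V \<Longrightarrow> hit U \<subseteq> hit V"
  by (auto simp: hit_def)

lemma nbhd_topspace: "x \<in> topspace X \<Longrightarrow> topspace X \<in> nbhd x"
  by (simp add: nbhd_def)

lemma nbhd_Int: "U \<in> nbhd x \<Longrightarrow> V \<in> nbhd x \<Longrightarrow> U \<inter> V \<in> nbhd x"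
  by (auto simp: nbhd_def)

lemma m_le: "U \<in> nbhd x \<Longrightarrow> m x \<le> L (hit U)"
  unfolding m_def by (intro cINF_lower bdd_belowI2[of _ 0] L_nonneg)

lemma m_ge:
  assumes "x \<in> topspace X" "\<And>U. U \<in> nbhd x \<Longrightarrow> a \<le> L (hit U)"
  shows "a \<le> m x"
  unfolding m_def using assms nbhd_topspace by (intro cINF_greatest) auto

lemma k_le: "U \<in> nbhd x \<Longrightarrow> V \<in> nbhd y \<Longrightarrow> k x y \<le> L (hit U \<inter> hit V)"
  unfolding k_def
  using cINF_lower[of "\<lambda>p. L (hit (fst p) \<inter> hit (snd p))" "nbhd x \<times> nbhd y" "(U, V)"]
    bdd_belowI2[of "nbhd x \<times> nbhd y" 0 "\<lambda>p. L (hit (fst p) \<inter> hit (snd p))"] L_nonneg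
  by simp

lemma k_ge:
  assumes "x \<in> topspace X" "y \<in> topspace X"
    "\<And>U V. U \<in> nbhd x \<Longrightarrow> V \<in> nbhd y \<Longrightarrow> a \<le> L (hit U \<inter> hit V)"
  shows "a \<le> k x y"
  unfolding k_def
proof (rule cINF_greatest)
  show "nbhd x \<times> nbhd y \<noteq> {}" using nbhd_topspace assms(1,2) by blast
qed (use assms(3) in auto)

text \<open>\<open>pre (- g) U\<close> is the translate of \<open>U\<close> by \<open>g\<close>. The
  point \<open>act g y\<close> enters \<open>Q\<close> at time \<open>h\<close> exactly when
  \<open>y\<close> does at time \<open>g + h\<close>, so hitting times are merely shifted, which
  \<open>L\<close> does not see.\<close>

lemma nbhd_translate:
  assumes "U \<in> nbhd x" "x \<in> topspace X"
  shows "pre (- g) U \<in> nbhd (act g x)" "hit (pre (- g) U) = shift_set g (hit U)"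
proof -
  show "pre (- g) U \<in> nbhd (act g x)"
    using assms openin_pre[of U "- g"] by (auto simp: nbhd_def pre_def)
  have U: "y \<in> topspace X" if "y \<in> U" for y
    using assms that openin_subset by (auto simp: nbhd_def)
  show "hit (pre (- g) U) = shift_set g (hit U)"
  proof (intro equalityI subsetI)
    fix h assume "h \<in> hit (pre (- g) U)"
    then obtain y where y: "y \<in> topspace X" "act (- g) y \<in> U" "act h y \<in> Q"
      by (auto simp: hit_def pre_def)
    moreover have "act (g + h) (act (- g) y) = act h y"
      using y by (simp add: add.commute[of g h] act_add)
    ultimately show "h \<in> shift_set g (hit U)" by (auto simp: shift_set_def hit_def intro!: bexI[of _ "act (- g) y"])
  next
    fix h assume "h \<in> shift_set g (hit U)"
    then obtain y where y: "y \<in> U" "act (g + h) y \<in> Q" by (auto simp: shift_set_def hit_def)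
    then have "act g y \<in> pre (- g) U" "act h (act g y) \<in> Q"
      using U[OF y(1)] by (auto simp: pre_def add.commute[of g h] act_add)
    then show "h \<in> hit (pre (- g) U)" by (auto simp: hit_def)
  qed
qed

text \<open>The orbit of \<open>x\<close> enters every neighbourhood of \<open>y\<close>;
  translating back gives a neighbourhood of \<open>x\<close> whose hitting times have the same
  charge.\<close>

lemma m_const_le:
  assumes x: "x \<in> topspace X" and y: "y \<in> topspace X"
  shows "m x \<le> m y"
proof (rule m_ge[OF y])
  fix U assume U: "U \<in> nbhd y"
  obtain g where g: "act g x \<in> U" using minimalD[of U x] U x by (auto simp: nbhd_def)
  then have "U \<in> nbhd (act g x)" using U by (auto simp: nbhd_def)
  from nbhd_translate[OF this, of "- g"] have "m x \<le> L (shift_set (- g) (hit U))"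
    using m_le[of "pre (- (- g)) U" x] x by simp
  then show "m x \<le> L (hit U)" by (simp add: shift_invariant)
qed

lemma m_const: "x \<in> topspace X \<Longrightarrow> y \<in> topspace X \<Longrightarrow> m x = m y"
  by (intro antisym m_const_le)

lemma k_translate_le:
  assumes x: "x \<in> topspace X" and y: "y \<in> topspace X"
  shows "k (act g x) (act g y) \<le> k x y"
proof (rule k_ge[OF x y])
  fix U V assume "U \<in> nbhd x" "V \<in> nbhd y"
  then have "k (act g x) (act g y) \<le> L (shift_set g (hit U) \<inter> shift_set g (hit V))"
    using k_le nbhd_translate x y by metis
  then show "k (act g x) (act g y) \<le> L (hit U \<inter> hit V)"
    by (simp add: shift_invariant flip: shift_set_Int)
qed

lemma k_translate:
  assumes "x \<in> topspace X" "y \<in> topspace X"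
  shows "k (act g x) (act g y) = k x y"
  using k_translate_le[of x y g] k_translate_le[of "act g x" "act g y" "- g"] assms by auto

lemma k_diag: 
  assumes x: "x \<in> topspace X"
  shows "k x x = m x"
proof (rule antisym)
  show "k x x \<le> m x"
    using k_le by (intro m_ge[OF x]) fastforce
  show "m x \<le> k x x"
  proof (rule k_ge[OF x x])
    fix U V assume "U \<in> nbhd x" "V \<in> nbhd x"
    then have "m x \<le> L (hit (U \<inter> V))" by (intro m_le nbhd_Int)
    also have "\<dots> \<le> L (hit U \<inter> hit V)"
      by (intro prob_charge_mono[OF charge] Int_greatest hit_mono) auto
    finally show "m x \<le> L (hit U \<inter> hit V)" .
  qed
qed

text \<open>Shrinking a neighbourhood \<open>U\<close> of \<open>x\<close> around any of its points costs less than \<open>e\<close>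
  once \<open>L (hit U) < m x + e\<close>, because \<open>m\<close> is constant.\<close>

lemma k_near:
  assumes x: "x \<in> topspace X" and "e > 0"
  shows "\<exists>U\<in>nbhd x. \<forall>y\<in>U. \<forall>z\<in>topspace X. \<bar>k x z - k y z\<bar> \<le> e"
proof -
  have "\<not> m x + e \<le> m x" using \<open>e > 0\<close> by simp
  then obtain U where U: "U \<in> nbhd x" "L (hit U) < m x + e"
    using m_ge[OF x] by (meson not_le)
  have UX: "U \<subseteq> topspace X" using U openin_subset by (auto simp: nbhd_def)
  have shrink: "L (hit U \<inter> hit V) - e \<le> L (hit P \<inter> hit V)" if "P \<in> nbhd y" "y \<in> U" for P y V
  proof -
    have PU: "P \<inter> U \<in> nbhd y" using that U by (auto simp: nbhd_def)
    have "m x = m y" using m_const x that UX by blast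
    then have "L (hit U - hit (P \<inter> U)) \<le> e"
      using U m_le[OF PU] prob_charge_Diff[OF charge, of "hit (P \<inter> U)" "hit U"] hit_mono[of "P \<inter> U" U]
      by simp
    moreover have "L (hit U \<inter> hit V) \<le> L ((hit P \<inter> hit V) \<union> (hit U - hit (P \<inter> U)))"
      by (intro prob_charge_mono[OF charge]) (auto simp: hit_def)
    ultimately show ?thesis
      using prob_charge_Un_le[OF charge, of "hit P \<inter> hit V" "hit U - hit (P \<inter> U)"] by linarith
  qed
  \<comment> \<open>The loss in \<open>shrink\<close> does not depend on \<open>V\<close>, so the
    infima defining \<open>k\<close> inherit it uniformly in \<open>z\<close>.\<close>
  have le: "k a z - e \<le> k b z" if "a \<in> U" "b \<in> U" "z \<in> topspace X" for a b z
  proof (rule k_ge)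
    fix P V assume PV: "P \<in> nbhd b" "V \<in> nbhd z"
    have "k a z \<le> L (hit U \<inter> hit V)" using U PV \<open>a \<in> U\<close> by (intro k_le) (auto simp: nbhd_def)
    then show "k a z - e \<le> L (hit P \<inter> hit V)" using shrink[OF PV(1) \<open>b \<in> U\<close>, of V] by linarith
  qed (use that UX in auto)
  have "x \<in> U" using U by (simp add: nbhd_def)
  then have "\<forall>y\<in>U. \<forall>z\<in>topspace X. \<bar>k x z - k y z\<bar> \<le> e"
    using le by (fastforce simp: abs_le_iff)
  then show ?thesis using U by blast
qed

section \<open>The invariant pseudometric induced by the kernel\<close>

definition d :: "'a \<Rightarrow> 'a \<Rightarrow> real" where
  "d x y = (SUP z\<in>topspace X. \<bar>k x z - k y z\<bar>)"

lemma k_bounds: 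
  assumes x: "x \<in> topspace X" and y: "y \<in> topspace X" shows "0 \<le> k x y" "k x y \<le> 1"
proof -
  show "0 \<le> k x y" by (rule k_ge[OF x y L_nonneg])
  show "k x y \<le> 1"
    by (rule order_trans[OF k_le[OF nbhd_topspace[OF x] nbhd_topspace[OF y]] prob_charge_le_1[OF charge]])
qed

lemma d_ge:
  assumes "x \<in> topspace X" "y \<in> topspace X" "z \<in> topspace X"
  shows "\<bar>k x z - k y z\<bar> \<le> d x y"
  unfolding d_def using assms(3)
proof (intro cSUP_upper bdd_aboveI2)
  fix u assume u: "u \<in> topspace X"
  show "\<bar>k x u - k y u\<bar> \<le> 1"
    using k_bounds[OF assms(1) u] k_bounds[OF assms(2) u] by linarith
qed

lemma d_le:
  assumes "x \<in> topspace X" "\<And>z. z \<in> topspace X \<Longrightarrow> \<bar>k x z - k y z\<bar> \<le> a"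
  shows "d x y \<le> a"
  unfolding d_def
proof (rule cSUP_least)
  show "topspace X \<noteq> {}" using assms(1) by blast
qed (rule assms(2))

text \<open>Invariance of \<open>k\<close> moves the translation onto \<open>z\<close>, which only
  reindexes the supremum.\<close>

lemma d_translate_le:
  assumes "x \<in> topspace X" "y \<in> topspace X"
  shows "d (act g x) (act g y) \<le> d x y"
proof (rule d_le)
  fix z assume z: "z \<in> topspace X"
  have "k (act g w) z = k w (act (- g) z)" if "w \<in> topspace X" for w
    using k_translate[of w "act (- g) z" g] that z by simp
  then show "\<bar>k (act g x) z - k (act g y) z\<bar> \<le> d x y"
    using d_ge[of x y "act (- g) z"] assms z by simp
qed (use assms in simp)

lemma invariant_pseudometric_d: "invariant_pseudometric d"
proof -
  have nonneg: "0 \<le> d x y" if "x \<in> topspace X" "y \<in> topspace X" for x y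
    using order_trans[OF abs_ge_zero d_ge[OF that that(1)]] .
  have refl: "d x x = 0" if "x \<in> topspace X" for x
    by (intro antisym nonneg d_le that) simp
  have sym: "d x y = d y x" for x y
    unfolding d_def by (simp add: abs_minus_commute)
  have inv: "d (act g x) (act g y) = d x y" if "x \<in> topspace X" "y \<in> topspace X" for x y g
    using d_translate_le[of x y g] d_translate_le[of "act g x" "act g y" "- g"] that by simp
  have tri: "d x z \<le> d x y + d y z"
    if "x \<in> topspace X" "y \<in> topspace X" "z \<in> topspace X" for x y z
  proof (rule d_le[OF that(1)])
    fix u assume u: "u \<in> topspace X"
    show "\<bar>k x u - k z u\<bar> \<le> d x y + d y z"
      using d_ge[OF that(1,2) u] d_ge[OF that(2,3) u] by linarith
  qed
  have cont: "\<exists>U. openin X U \<and> x \<in> U \<and> (\<forall>y\<in>U. d x y < e)"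
    if x: "x \<in> topspace X" and "e > 0" for x e
  proof -
    obtain U where U: "U \<in> nbhd x" "\<forall>y\<in>U. \<forall>z\<in>topspace X. \<bar>k x z - k y z\<bar> \<le> e / 2"
      using k_near[OF x, of "e / 2"] \<open>e > 0\<close> by (metis half_gt_zero)
    have "d x y < e" if "y \<in> U" for y
    proof -
      have "d x y \<le> e / 2" using U(2) that by (intro d_le[OF x]) simp
      then show ?thesis using \<open>e > 0\<close> by simp
    qed
    then show ?thesis using U(1) unfolding nbhd_def by blast
  qed
  show ?thesis
    unfolding invariant_pseudometric_def
    by (intro conjI ballI allI impI nonneg refl sym inv tri cont)
qed

text \<open>The separation shows at \<open>z = y\<close>: every neighbourhood of \<open>y\<close>
  hits \<open>Q\<close> throughout \<open>A\<close>, while \<open>W\<close> never does so during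
  \<open>A\<close>, so \<open>k y y\<close> exceeds \<open>k x y\<close> by at least
  \<open>L A\<close>.\<close>

lemma d_pos:
  assumes x: "x \<in> topspace X" and y: "y \<in> topspace X" and "L A > 0"
    and "\<And>V. V \<in> nbhd y \<Longrightarrow> A \<subseteq> hit V" and "W \<in> nbhd x" "A \<inter> hit W = {}"
  shows "d x y > 0"
proof -
  have "k x y + L A \<le> m y"
  proof (rule m_ge[OF y])
    fix V assume V: "V \<in> nbhd y"
    have "k x y \<le> L (hit W \<inter> hit V)" using assms V by (intro k_le)
    also have "\<dots> \<le> L (hit V - A)" using assms by (intro prob_charge_mono[OF charge]) auto
    also have "\<dots> = L (hit V) - L A" using assms V by (intro prob_charge_Diff[OF charge])
    finally show "k x y + L A \<le> L (hit V)" by simp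
  qed
  then show ?thesis using d_ge[OF x y y] k_diag[OF y] \<open>L A > 0\<close> by linarith
qed

end

section \<open>Jumps and independence\<close>

context minimal_gsys
begin

text \<open>The equicontinuous structure relation, presented through pseudometrics.\<close>

definition eq_related :: "'a \<Rightarrow> 'a \<Rightarrow> bool" where
  "eq_related x y \<longleftrightarrow> x \<in> topspace X \<and> y \<in> topspace X \<and>
     (\<forall>d. invariant_pseudometric d \<longrightarrow> d x y = 0)"

text \<open>If no such \<open>r\<close> existed, a suitable \<open>Q\<close> would give the kernel
  pseudometric a positive value at \<open>w\<close>, \<open>w'\<close>: the common visiting times
  \<open>A\<close> of the points \<open>e V\<close> would lie in every \<open>hit V\<close> with
  \<open>V\<close> near \<open>w'\<close> but miss \<open>hit W\<close>.\<close>

lemma jump: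
  assumes W: "openin X W" "w \<in> W" and w': "w' \<in> X closure_of U" and rel: "eq_related w w'"
    and U: "openin X U" and \<V>: "finite \<V>" "\<And>V. V \<in> \<V> \<Longrightarrow> openin X V \<and> V \<noteq> {}"
  shows "\<exists>r. (\<forall>V\<in>\<V>. V \<inter> pre r V \<noteq> {}) \<and> U \<inter> pre r W \<noteq> {}"
proof (rule ccontr)
  assume none: "\<not> ?thesis"
  have wX: "w \<in> topspace X" "w' \<in> topspace X" using rel by (auto simp: eq_related_def)
  have WX: "W \<subseteq> topspace X" and UX: "U \<subseteq> topspace X"
    using W(1) U openin_subset by auto
  obtain L :: "'g set \<Rightarrow> real" where L: "prob_charge L" and inv: "\<And>g B. L (shift_set g B) = L B"
    using ex_invariant_charge by blast
  have "L UNIV > 0" using L by (simp add: prob_charge_def)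
  then obtain e where e: "\<And>V. V \<in> \<V> \<Longrightarrow> e V \<in> topspace X"
    and pos: "L (UNIV \<inter> {g. \<forall>V\<in>\<V>. act g (e V) \<in> V}) > 0"
    using simultaneous_visits[OF L \<V>, of UNIV] wX(1) by blast
  define A where "A = {g. \<forall>V\<in>\<V>. act g (e V) \<in> V}"
  \<comment> \<open>Each time in \<open>A\<close> carries all of \<open>U\<close> into
    \<open>Q\<close>, and every neighbourhood of \<open>w'\<close> meets \<open>U\<close>.\<close>
  define Q where "Q = {y. \<exists>a\<in>A. \<exists>u\<in>U. y = act a u}"
  interpret charged_gsys X act L Q
    by unfold_locales (use L inv in auto)
  have "A \<subseteq> hit V" if V: "V \<in> nbhd w'" for V
  proof -
    obtain u where "u \<in> U" "u \<in> V" using w' V by (auto simp: nbhd_def in_closure_of)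
    then have "act g u \<in> Q" if "g \<in> A" for g using that unfolding Q_def by blast
    then show ?thesis using \<open>u \<in> V\<close> unfolding hit_def by blast
  qed
  moreover have "W \<in> nbhd w" using W unfolding nbhd_def by blast
  moreover have "A \<inter> hit W = {}"
  proof (rule ccontr)
    assume "A \<inter> hit W \<noteq> {}"
    \<comment> \<open>A common time \<open>g\<close> would produce the forbidden element
      \<open>- g + a\<close>: it sends \<open>u\<close> to \<open>x\<close> in \<open>W\<close>, and
      it sends \<open>act g (e V)\<close> to \<open>act a (e V)\<close>, both in \<open>V\<close>
      since \<open>g\<close> and \<open>a\<close> belong to \<open>A\<close>.\<close>
    then obtain g x where g: "g \<in> A" "x \<in> W" "act g x \<in> Q" unfolding hit_def by blast
    then obtain a u where a: "a \<in> A" "u \<in> U" "act g x = act a u" unfolding Q_def by blast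
    have "x \<in> topspace X" "u \<in> topspace X" using g a WX UX by auto
    then have "act (- g + a) u = x" using a(3) act_add[of u "- g" a] act_minus(1)[of x g] by simp
    then have "u \<in> U \<inter> pre (- g + a) W" using a g \<open>u \<in> topspace X\<close> by (simp add: pre_def)
    moreover have "act g (e V) \<in> V \<inter> pre (- g + a) V" if "V \<in> \<V>" for V
    proof -
      have "act (- g + a) (act g (e V)) = act a (e V)"
        using act_add[of "e V" "- g + a" g] e[OF that] by simp
      then show ?thesis using g a that e[OF that] by (auto simp: A_def pre_def)
    qed
    ultimately show False using none by blast
  qed
  ultimately have "d w w' > 0" using pos wX by (intro d_pos[of w w' A W]) (auto simp: A_def)
  then show False using rel invariant_pseudometric_d by (auto simp: eq_related_def)
qed

text \<open>If \<open>r\<close> already performs the jumps into \<open>\<W>\<close>, choose \<open>t\<close> jumping into \<open>W \<inter> r\<^sup>-\<^sup>1W\<close> and returning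
  \<open>U \<inter> r\<^sup>-\<^sup>1W'\<close> for \<open>W' \<in> \<W>\<close>; then \<open>r + t\<close> performs them all.\<close>

lemma simultaneous_jumps:
  assumes U: "openin X U"
    and rel: "\<And>w. w \<in> N \<Longrightarrow> \<exists>w'\<in>X closure_of U. eq_related w w'"
    and "finite \<W>" "\<And>W. W \<in> \<W> \<Longrightarrow> openin X W \<and> W \<noteq> {} \<and> W \<subseteq> N"
    and "finite \<V>" "\<And>V. V \<in> \<V> \<Longrightarrow> openin X V \<and> V \<noteq> {}"
  shows "\<exists>r. (\<forall>V\<in>\<V>. V \<inter> pre r V \<noteq> {}) \<and> (\<forall>W\<in>\<W>. U \<inter> pre r W \<noteq> {})"
  using assms(3-)
proof (induction arbitrary: \<V>)
  case empty
  have "V \<inter> pre 0 V \<noteq> {}" if "V \<in> \<V>" for V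
  proof -
    have "openin X V" "V \<noteq> {}" using empty.prems(3)[OF that] by auto
    then obtain x where "x \<in> V" "x \<in> topspace X" using openin_subset by blast
    then have "x \<in> V \<inter> pre 0 V" by (simp add: pre_def)
    then show ?thesis by blast
  qed
  then show ?case by auto
next
  case (insert W \<W>)
  \<comment> \<open>Adding \<open>W\<close> to the sets to be returned makes
    \<open>W \<inter> pre r W\<close> nonempty, so it can be the target of the next jump.\<close>
  have "\<exists>r. (\<forall>V\<in>insert W \<V>. V \<inter> pre r V \<noteq> {}) \<and> (\<forall>W\<in>\<W>. U \<inter> pre r W \<noteq> {})"
    using insert.prems by (intro insert.IH) auto
  then obtain r where r: "\<And>V. V \<in> insert W \<V> \<Longrightarrow> V \<inter> pre r V \<noteq> {}"
    "\<And>W. W \<in> \<W> \<Longrightarrow> U \<inter> pre r W \<noteq> {}"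
    by auto
  \<comment> \<open>Returning these sets under \<open>t\<close> upgrades what \<open>r\<close>
    achieves to \<open>r + t\<close>.\<close>
  define \<V>' where "\<V>' = (\<lambda>V. V \<inter> pre r V) ` \<V> \<union> (\<lambda>W. U \<inter> pre r W) ` \<W>"
  have "W \<inter> pre r W \<noteq> {}" using r by blast
  then obtain w where w: "w \<in> W \<inter> pre r W" by blast
  then have "w \<in> N" using insert.prems by auto
  then obtain w' where w': "w' \<in> X closure_of U" "eq_related w w'" using rel by blast
  have "\<exists>t. (\<forall>V\<in>\<V>'. V \<inter> pre t V \<noteq> {}) \<and> U \<inter> pre t (W \<inter> pre r W) \<noteq> {}"
  proof (rule jump[OF _ w w'(1,2) U])
    show "openin X (W \<inter> pre r W)" using insert.prems by (auto intro: openin_pre)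
    show "finite \<V>'" using insert by (simp add: \<V>'_def)
    show "openin X V \<and> V \<noteq> {}" if "V \<in> \<V>'" for V
      using that r insert.prems U by (auto simp: \<V>'_def intro!: openin_Int openin_pre)
  qed
  then obtain t where t: "\<And>V. V \<in> \<V>' \<Longrightarrow> V \<inter> pre t V \<noteq> {}" "U \<inter> pre t (W \<inter> pre r W) \<noteq> {}"
    by auto
  have comb: "A \<inter> pre (r + t) B \<noteq> {}" if ne: "A \<inter> pre t (pre r B) \<noteq> {}" for A B
  proof -
    obtain y where "y \<in> A" "y \<in> topspace X" "act r (act t y) \<in> B" using ne by (auto simp: pre_def)
    then show ?thesis using act_add[of y r t] by (auto simp: pre_def)
  qed
  have pre_mono: "pre t A \<subseteq> pre t B" if "A \<subseteq> B" for A B using that by (auto simp: pre_def)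
  have sub: "A \<inter> pre t (pre r B) \<noteq> {}" if "(A \<inter> D) \<inter> pre t (E \<inter> pre r B) \<noteq> {}" for A B D E
    using that by (auto simp: pre_def)
  have "V \<inter> pre (r + t) V \<noteq> {}" if "V \<in> \<V>" for V
    using t(1)[of "V \<inter> pre r V"] that by (intro comb sub[where D="pre r V" and E=V]) (auto simp: \<V>'_def)
  moreover have "U \<inter> pre (r + t) W' \<noteq> {}" if "W' \<in> \<W>" for W'
    using t(1)[of "U \<inter> pre r W'"] that by (intro comb sub[where D="pre r W'" and E=U]) (auto simp: \<V>'_def)
  moreover have "U \<inter> pre (r + t) W \<noteq> {}"
    using t(2) by (intro comb sub[where D=UNIV and E=W]) auto
  ultimately show ?case by (intro exI[of _ "r + t"]) auto
qed

text \<open>The set of times grows one element at a time while every pattern stays realised by a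
  point of \<open>N\<close>. Each new time is \<open>- r\<close> for a simultaneous jump
  \<open>r\<close> into all current cells: points arriving from \<open>U2\<close> realise the second
  choice, points returning from the same cell realise the first, because
  \<open>N \<subseteq> U1\<close>.\<close>

lemma infinite_indep_set:
  assumes N: "openin X N" "N \<noteq> {}" "N \<subseteq> U1" and U: "openin X U1" "openin X U2" "U1 \<inter> U2 = {}"
    and rel: "\<And>w. w \<in> N \<Longrightarrow> \<exists>w'\<in>X closure_of U2. eq_related w w'"
  shows "\<exists>J. infinite J \<and> indep_set X act U1 U2 J"
proof -
  \<comment> \<open>\<open>K\<close> encodes the pattern: the times in \<open>K\<close> are those
    assigned to \<open>U1\<close>.\<close>
  define cell where "cell J K = {x \<in> N. \<forall>s\<in>J. act s x \<in> (if s \<in> K then U1 else U2)}" for J K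
  define good where "good J \<longleftrightarrow> (\<forall>K. cell J K \<noteq> {})" for J
  have NX: "N \<subseteq> topspace X" using N openin_subset by auto
  have cell_insert: "cell (insert s J) K = cell J K \<inter> pre s (if s \<in> K then U1 else U2)" for s J K
    using NX by (auto simp: cell_def pre_def)
  have open_cell: "openin X (cell J K)" if "finite J" for J K
    using that
  proof induction
    case empty
    then show ?case using N by (simp add: cell_def)
  next
    case (insert s J)
    then show ?case unfolding cell_insert using U by (intro openin_Int openin_pre) auto
  qed
  have step: "\<exists>s. s \<notin> J \<and> good (insert s J)" if J: "finite J" "good J" for J
  proof -
    define \<W> where "\<W> = cell J ` Pow J"
    \<comment> \<open>Only \<open>K \<inter> J\<close> matters, so finitely many cells account for
      all patterns.\<close>
    have cell\<W>: "cell J K \<in> \<W>" for K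
    proof -
      have "cell J K = cell J (K \<inter> J)" by (auto simp: cell_def)
      then show ?thesis by (auto simp: \<W>_def)
    qed
    have \<W>: "finite \<W>" "\<And>W. W \<in> \<W> \<Longrightarrow> openin X W \<and> W \<noteq> {} \<and> W \<subseteq> N"
      using J open_cell by (auto simp: \<W>_def good_def) (auto simp: cell_def)
    have "\<exists>r. (\<forall>V\<in>\<W>. V \<inter> pre r V \<noteq> {}) \<and> (\<forall>W\<in>\<W>. U2 \<inter> pre r W \<noteq> {})"
      by (rule simultaneous_jumps[OF U(2) rel \<W> \<W>(1)]) (use \<W> in auto)
    then obtain r where r: "\<And>W. W \<in> \<W> \<Longrightarrow> W \<inter> pre r W \<noteq> {}" "\<And>W. W \<in> \<W> \<Longrightarrow> U2 \<inter> pre r W \<noteq> {}"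
      by auto
    have to_U1: "\<exists>x\<in>cell J K. act (- r) x \<in> U1" for K
    proof -
      obtain y where "y \<in> cell J K" "y \<in> pre r (cell J K)" using r(1)[OF cell\<W>, of K] by blast
      then have "act r y \<in> cell J K" "act (- r) (act r y) \<in> U1"
        using N(3) by (auto simp: pre_def cell_def)
      then show ?thesis by blast
    qed
    have to_U2: "\<exists>x\<in>cell J K. act (- r) x \<in> U2" for K
    proof -
      obtain y where "y \<in> U2" "y \<in> pre r (cell J K)" using r(2)[OF cell\<W>, of K] by blast
      then have "act r y \<in> cell J K" "act (- r) (act r y) \<in> U2" by (auto simp: pre_def)
      then show ?thesis by blast
    qed
    have "good (insert (- r) J)"
      unfolding good_def
    proof
      fix K
      obtain x where "x \<in> cell J K" "act (- r) x \<in> (if - r \<in> K then U1 else U2)"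
        using to_U1[of K] to_U2[of K] by (cases "- r \<in> K") auto
      moreover have "x \<in> topspace X" using calculation NX by (auto simp: cell_def)
      ultimately show "cell (insert (- r) J) K \<noteq> {}" unfolding cell_insert pre_def by blast
    qed
    \<comment> \<open>In the cell of the constant pattern \<open>U1\<close>, an old time could not
      lead to \<open>U2\<close>, which is disjoint from \<open>U1\<close>.\<close>
    moreover have "- r \<notin> J"
    proof
      assume "- r \<in> J"
      then have "act (- r) x \<in> U1" if "x \<in> cell J J" for x using that by (auto simp: cell_def)
      then show False using to_U2[of J] U(3) by blast
    qed
    ultimately show ?thesis by blast
  qed
  have "\<exists>f. \<forall>n::nat. (finite (f n) \<and> good (f n)) \<and> f n \<subset> f (Suc n)"
  proof (rule dependent_nat_choice)
    show "\<exists>J. finite J \<and> good J"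
      using N(2) by (intro exI[of _ "{}"]) (auto simp: good_def cell_def)
    show "\<exists>J'. (finite J' \<and> good J') \<and> J \<subset> J'" if "finite J \<and> good J" for J
      using step[of J] that by (metis finite_insert insertI1 psubsetI subset_insertI)
  qed
  then obtain f :: "nat \<Rightarrow> 'g set" where f: "\<And>n. finite (f n)" "\<And>n. good (f n)" "\<And>n. f n \<subset> f (Suc n)"
    by metis
  have "strict_mono f" using f(3) by (simp add: strict_mono_Suc_iff)
  then have "inj f" "mono f" by (auto intro: strict_mono_imp_inj_on strict_mono_mono)
  have "infinite (\<Union>n. f n)"
  proof
    assume "finite (\<Union>n. f n)"
    then have "finite (Pow (\<Union>n. f n))" by simp
    moreover have "range f \<subseteq> Pow (\<Union>n. f n)" by auto
    ultimately have "finite (range f)" by (rule finite_subset[rotated])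
    then show False using \<open>inj f\<close> finite_imageD infinite_UNIV_nat by blast
  qed
  moreover have "indep_set X act U1 U2 (\<Union>n. f n)"
    unfolding indep_set_def
  proof (intro allI impI, elim conjE)
    fix I and \<sigma> :: "'g \<Rightarrow> bool" assume I: "finite I" "I \<noteq> {}" "I \<subseteq> (\<Union>n. f n)"
    have "\<exists>n. I \<subseteq> f n" using I(1,3)
    proof induction
      case (insert i I)
      then obtain n n' where "I \<subseteq> f n" "i \<in> f n'" by auto
      then have "insert i I \<subseteq> f (max n n')"
        using monoD[OF \<open>mono f\<close>, of n "max n n'"] monoD[OF \<open>mono f\<close>, of n' "max n n'"] by auto
      then show ?case by blast
    qed simp
    then obtain n where n: "I \<subseteq> f n" by blast
    obtain x where x: "x \<in> cell (f n) (Collect \<sigma>)" using f(2)[of n] unfolding good_def by blast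
    then have "x \<in> topspace X" using NX by (auto simp: cell_def)
    moreover have "act s x \<in> (if \<sigma> s then U1 else U2)" if "s \<in> I" for s
    proof -
      have "s \<in> f n" using that n by blast
      then show ?thesis using x unfolding cell_def mem_Collect_eq by blast
    qed
    ultimately have "x \<in> (\<Inter>s\<in>I. {x \<in> topspace X. act s x \<in> (if \<sigma> s then U1 else U2)})"
      by blast
    then show "(\<Inter>s\<in>I. {x \<in> topspace X. act s x \<in> (if \<sigma> s then U1 else U2)}) \<noteq> {}" by blast
  qed
  ultimately show ?thesis by blast
qed

end

section \<open>Extensions of minimal systems\<close>

lemma indep_set_mono:
  assumes "indep_set X act U V J" "U \<subseteq> U'" "V \<subseteq> V'"
  shows "indep_set X act U' V' J"
  unfolding indep_set_def
proof (intro allI impI)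
  fix I and \<sigma> :: "'b \<Rightarrow> bool" assume I: "finite I \<and> I \<noteq> {} \<and> I \<subseteq> J"
  have "(\<Inter>s\<in>I. {x \<in> topspace X. act s x \<in> (if \<sigma> s then U else V)}) \<noteq> {}"
    using assms(1) I unfolding indep_set_def by blast
  moreover have "(\<Inter>s\<in>I. {x \<in> topspace X. act s x \<in> (if \<sigma> s then U else V)})
      \<subseteq> (\<Inter>s\<in>I. {x \<in> topspace X. act s x \<in> (if \<sigma> s then U' else V')})"
    using assms(2,3) by (intro INF_mono) auto
  ultimately show "(\<Inter>s\<in>I. {x \<in> topspace X. act s x \<in> (if \<sigma> s then U' else V')}) \<noteq> {}"
    by blast
qed

lemma interior_of_finite_Union_empty:
  assumes "finite I" "\<And>i. i \<in> I \<Longrightarrow> closedin Y (C i)" "\<And>i. i \<in> I \<Longrightarrow> Y interior_of (C i) = {}"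
  shows "Y interior_of (\<Union>i\<in>I. C i) = {}"
  using assms by (induction I) (auto simp: interior_of_union_eq_empty)

locale minimal_extension = X: minimal_gsys X actX + Y: minimal_gsys Y actY
  for X :: "'a topology" and actX :: "'g::topological_ab_group_add \<Rightarrow> 'a \<Rightarrow> 'a"
    and Y :: "'b topology" and actY :: "'g \<Rightarrow> 'b \<Rightarrow> 'b" +
  fixes \<pi> :: "'a \<Rightarrow> 'b"
  assumes ext: "extension X actX Y actY \<pi>"
begin

lemma continuous: "continuous_map X Y \<pi>" and surj: "\<pi> ` topspace X = topspace Y"
  and equivariant: "x \<in> topspace X \<Longrightarrow> \<pi> (actX s x) = actY s (\<pi> x)"
  using ext by (auto simp: extension_def)

lemma in_topspace: "x \<in> topspace X \<Longrightarrow> \<pi> x \<in> topspace Y"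
  using surj by blast

lemma closed_image: "closedin X C \<Longrightarrow> closedin Y (\<pi> ` C)"
  using continuous_imp_closed_map[OF continuous X.compact Y.Hausdorff] by (simp add: closed_map_def)

lemma interior_image:
  assumes C: "closedin X C" and U: "openin X U" "U \<noteq> {}" "U \<subseteq> C"
  shows "Y interior_of (\<pi> ` C) \<noteq> {}"
proof
  assume empty: "Y interior_of (\<pi> ` C) = {}"
  obtain F where F: "finite F" "topspace X \<subseteq> (\<Union>g\<in>F. X.pre g U)"
    using X.finite_cover[OF U(1,2)] by blast
  define D where "D g = {y \<in> topspace Y. actY g y \<in> \<pi> ` C}" for g
  have "Y interior_of (D g) = {}" for g
  proof (rule ccontr)
    assume "Y interior_of (D g) \<noteq> {}"
    then obtain y where y: "y \<in> Y interior_of (D g)" by blast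
    have "Y.pre (- g) (Y interior_of (D g)) \<subseteq> \<pi> ` C"
    proof
      fix z assume "z \<in> Y.pre (- g) (Y interior_of (D g))"
      then have z: "z \<in> topspace Y" "actY (- g) z \<in> D g"
        using interior_of_subset unfolding Y.pre_def by fast+
      then show "z \<in> \<pi> ` C" by (simp add: D_def)
    qed
    then have "Y.pre (- g) (Y interior_of (D g)) \<subseteq> Y interior_of (\<pi> ` C)"
      by (intro interior_of_maximal Y.openin_pre) auto
    moreover have "actY g y \<in> Y.pre (- g) (Y interior_of (D g))"
      using y interior_of_subset_topspace[of Y "D g"] by (auto simp: Y.pre_def)
    ultimately show False using empty by blast
  qed
  moreover have "closedin Y (D g)" for g
    unfolding D_def by (rule closedin_continuous_map_preimage[OF Y.continuous_act closed_image[OF C]])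
  ultimately have "Y interior_of (\<Union>g\<in>F. D g) = {}"
    using F(1) by (intro interior_of_finite_Union_empty)
  moreover have "topspace Y \<subseteq> (\<Union>g\<in>F. D g)"
  proof
    fix y assume y: "y \<in> topspace Y"
    then obtain x where x: "x \<in> topspace X" "y = \<pi> x" using surj by blast
    then obtain g where "g \<in> F" "actX g x \<in> U" using F(2) by (auto simp: X.pre_def)
    then have "actY g y \<in> \<pi> ` C" using x U(3) by (auto simp flip: equivariant)
    then show "y \<in> (\<Union>g\<in>F. D g)" using y \<open>g \<in> F\<close> by (auto simp: D_def)
  qed
  ultimately have "topspace Y = {}"
    using interior_of_mono[of "topspace Y" "\<Union>g\<in>F. D g" Y] by simp
  then have "topspace X = {}" using surj by simp
  then show False using U openin_subset by blast
qed

text \<open>If \<open>\<pi>\<close> is not irreducible, then a proper closed set \<open>F\<close> with full image meets, over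
  some open set of base points, small sets away from \<open>F\<close>; compactness localises this at a pair.\<close>

lemma ex_fat_pair:
  assumes F: "closedin X F" "F \<noteq> topspace X" "\<pi> ` F = topspace Y"
  shows "\<exists>a b. a \<in> topspace X \<and> b \<in> topspace X \<and> a \<noteq> b \<and>
    (\<forall>U V. openin X U \<and> a \<in> U \<and> openin X V \<and> b \<in> V \<longrightarrow>
       Y interior_of (\<pi> ` (X closure_of U) \<inter> \<pi> ` (X closure_of V)) \<noteq> {})"
proof -
  have "openin X (topspace X - F)" using F(1) by blast
  moreover obtain x where "x \<in> topspace X - F" using F closedin_subset by blast
  \<comment> \<open>Regularity supplies a closed neighbourhood \<open>C\<close> of \<open>x\<close>
    disjoint from \<open>F\<close>; points of \<open>C\<close> and \<open>F\<close> are then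
    automatically distinct.\<close>
  ultimately obtain U1 C where U1: "openin X U1" "x \<in> U1" "U1 \<subseteq> C" "closedin X C" "C \<subseteq> topspace X - F"
    using X.regular unfolding neighbourhood_base_of_closedin[symmetric] neighbourhood_base_of by meson
  let ?fat = "\<lambda>a b. \<forall>U V. openin X U \<and> a \<in> U \<and> openin X V \<and> b \<in> V \<longrightarrow>
       Y interior_of (\<pi> ` (X closure_of U) \<inter> \<pi> ` (X closure_of V)) \<noteq> {}"
  have "\<exists>a\<in>C. \<exists>b\<in>F. ?fat a b"
  proof (rule ccontr)
    assume none: "\<not> ?thesis"
    define \<G> where "\<G> = {(U, V). openin X U \<and> openin X V \<and>
       Y interior_of (\<pi> ` (X closure_of U) \<inter> \<pi> ` (X closure_of V)) = {}}"
    have "compactin (prod_topology X X) (C \<times> F)"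
      using closedin_compact_space[OF X.compact U1(4)] closedin_compact_space[OF X.compact F(1)]
      by (simp add: compactin_Times)
    moreover have "openin (prod_topology X X) S" if S: "S \<in> (\<lambda>(U, V). U \<times> V) ` \<G>" for S
      using S by (auto simp: \<G>_def openin_prod_Times_iff)
    moreover have "C \<times> F \<subseteq> \<Union> ((\<lambda>(U, V). U \<times> V) ` \<G>)"
    proof clarify
      fix a b assume "a \<in> C" "b \<in> F"
      then obtain U V where "(U, V) \<in> \<G>" "a \<in> U" "b \<in> V"
        using none unfolding \<G>_def by blast
      then show "(a, b) \<in> \<Union> ((\<lambda>(U, V). U \<times> V) ` \<G>)" by force
    qed
    ultimately obtain \<F> where \<F>: "finite \<F>" "\<F> \<subseteq> (\<lambda>(U, V). U \<times> V) ` \<G>" "C \<times> F \<subseteq> \<Union>\<F>"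
      using compactinD by meson
    obtain \<H> where \<H>: "finite \<H>" "\<H> \<subseteq> \<G>" "\<F> = (\<lambda>(U, V). U \<times> V) ` \<H>"
      using finite_subset_image[OF \<F>(1,2)] by blast
    define D where "D = (\<lambda>(U, V). \<pi> ` (X closure_of U) \<inter> \<pi> ` (X closure_of V))"
    have "Y interior_of (\<Union>p\<in>\<H>. D p) = {}"
    proof (rule interior_of_finite_Union_empty[OF \<H>(1)])
      fix p assume "p \<in> \<H>"
      then show "Y interior_of (D p) = {}" using \<H>(2) by (auto simp: D_def \<G>_def)
      show "closedin Y (D p)" by (cases p) (auto simp: D_def intro!: closed_image)
    qed
    moreover have "\<pi> ` C \<subseteq> (\<Union>p\<in>\<H>. D p)"
    proof clarify
      fix a assume a: "a \<in> C"
      then have "\<pi> a \<in> topspace Y" using U1(4) closedin_subset in_topspace by blast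
      \<comment> \<open>As \<open>F\<close> maps onto \<open>Y\<close>, each \<open>a\<close> in
        \<open>C\<close> has a partner in its own fibre, and the rectangle containing the pair
        places \<open>\<pi> a\<close> in one of the overlaps.\<close>
      then obtain b where b: "b \<in> F" "\<pi> b = \<pi> a" using F(3) by (metis imageE)
      then obtain S where S: "S \<in> \<F>" "(a, b) \<in> S" using \<F>(3) a by blast
      then obtain U V where UV: "(U, V) \<in> \<H>" "a \<in> U" "b \<in> V" using \<H>(3) by auto
      then have "openin X U" "openin X V" using \<H>(2) by (auto simp: \<G>_def)
      then have "a \<in> X closure_of U" "b \<in> X closure_of V"
        using UV closure_of_subset[OF openin_subset, of X U] closure_of_subset[OF openin_subset, of X V]
        by auto
      then have "\<pi> a \<in> \<pi> ` (X closure_of U)" "\<pi> a \<in> \<pi> ` (X closure_of V)"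
        using b(2) by (metis imageI)+
      then have "\<pi> a \<in> D (U, V)" by (simp add: D_def)
      then show "\<pi> a \<in> (\<Union>p\<in>\<H>. D p)" using UV(1) by blast
    qed
    ultimately have "Y interior_of (\<pi> ` C) = {}"
      using interior_of_mono[of "\<pi> ` C" "\<Union>p\<in>\<H>. D p" Y] by simp
    then show False using interior_image[OF U1(4,1) _ U1(3)] U1(2) by blast
  qed
  then obtain a b where ab: "a \<in> C" "b \<in> F" "?fat a b" by blast
  have "a \<in> topspace X" "b \<in> topspace X" "a \<noteq> b"
    using ab(1,2) U1(5) closedin_subset[OF F(1)] by auto
  then show ?thesis using ab(3) by blast
qed

text \<open>Preimages of disjoint open sets \<open>P\<close>, \<open>Q\<close> around the two images
  cannot overlap fatly: an open set inside both closures would meet \<open>P\<close>, and then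
  \<open>P \<inter> Q\<close>.\<close>

lemma fat_pair_in_fibre:
  assumes "a \<in> topspace X" "b \<in> topspace X"
    and fat: "\<And>U V. openin X U \<Longrightarrow> a \<in> U \<Longrightarrow> openin X V \<Longrightarrow> b \<in> V \<Longrightarrow>
       Y interior_of (\<pi> ` (X closure_of U) \<inter> \<pi> ` (X closure_of V)) \<noteq> {}"
  shows "\<pi> a = \<pi> b"
proof (rule ccontr)
  assume "\<pi> a \<noteq> \<pi> b"
  then obtain P Q where PQ: "openin Y P" "openin Y Q" "\<pi> a \<in> P" "\<pi> b \<in> Q" "disjnt P Q"
    using Y.Hausdorff assms(1,2) in_topspace unfolding Hausdorff_space_def by metis
  define U where "U = {x \<in> topspace X. \<pi> x \<in> P}"
  define V where "V = {x \<in> topspace X. \<pi> x \<in> Q}"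
  define G where "G = Y interior_of (\<pi> ` (X closure_of U) \<inter> \<pi> ` (X closure_of V))"
  have "openin X U" "openin X V"
    unfolding U_def V_def using continuous PQ by (auto intro: openin_continuous_map_preimage)
  then have "G \<noteq> {}" using fat PQ assms(1,2) by (auto simp: G_def U_def V_def)
  have "\<pi> ` U \<subseteq> P" "\<pi> ` V \<subseteq> Q" by (auto simp: U_def V_def)
  then have "\<pi> ` (X closure_of U) \<subseteq> Y closure_of P" "\<pi> ` (X closure_of V) \<subseteq> Y closure_of Q"
    using continuous_map_image_closure_subset[OF continuous, of U]
      continuous_map_image_closure_subset[OF continuous, of V]
      closure_of_mono[of "\<pi> ` U" P Y] closure_of_mono[of "\<pi> ` V" Q Y]
    by blast+
  then have GP: "G \<subseteq> Y closure_of P" and GQ: "G \<subseteq> Y closure_of Q"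
    unfolding G_def using interior_of_subset by fast+
  have "openin Y G" by (simp add: G_def)
  then have "G \<inter> P \<noteq> {}" 
    using GP \<open>G \<noteq> {}\<close> openin_Int_closure_of_eq_empty[of Y G P] by blast
  then have "(G \<inter> P) \<inter> Q \<noteq> {}"
    using GQ \<open>openin Y G\<close> PQ(1) openin_Int_closure_of_eq_empty[of Y "G \<inter> P" Q] by blast
  then show False using PQ(5) by (auto simp: disjnt_def)
qed

text \<open>Failure of high proximality produces a fat pair, and jumps between its neighbourhoods
  make it a nondiagonal IT-pair in one fibre, against tameness.\<close>

lemma highly_proximal_if_eq_related:
  assumes tame: "tame_ext X actX \<pi>"
    and rel: "\<And>x y. (x, y) \<in> R_rel X \<pi> \<Longrightarrow> X.eq_related x y"
  shows "highly_proximal_ext X actX Y \<pi>"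
proof (rule ccontr)
  assume "\<not> ?thesis"
  then obtain U z where U: "openin X U" "U \<noteq> {}" "z \<in> topspace Y"
    and no: "\<And>s. \<not> {x \<in> topspace X. \<pi> x = z} \<subseteq> actX s ` U"
    unfolding highly_proximal_ext_def by blast
  define F where "F = topspace X - U"
  have F: "closedin X F" using U(1) unfolding F_def by blast
  have orbit: "actY s z \<in> \<pi> ` F" for s
  proof -
    obtain x where x: "x \<in> topspace X" "\<pi> x = z" "x \<notin> actX (- s) ` U" using no[of "- s"] by blast
    have "actX s x \<notin> U" using x X.act_minus(1)[of x s] by (metis image_eqI)
    then have "actX s x \<in> F" using x by (simp add: F_def)
    then show ?thesis using x equivariant[of x s] by (metis image_eqI)
  qed
  have "openin Y (topspace Y - \<pi> ` F)" using closed_image[OF F] by blast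
  then have "topspace Y - \<pi> ` F = {}" using Y.minimalD[of "topspace Y - \<pi> ` F" z] orbit U(3) by blast
  moreover have "\<pi> ` F \<subseteq> topspace Y" using in_topspace by (auto simp: F_def)
  ultimately have F_image: "\<pi> ` F = topspace Y" by blast
  have "F \<noteq> topspace X" using U openin_subset by (auto simp: F_def)
  then obtain a b where ab: "a \<in> topspace X" "b \<in> topspace X" "a \<noteq> b"
    and fat: "\<And>U V. openin X U \<Longrightarrow> a \<in> U \<Longrightarrow> openin X V \<Longrightarrow> b \<in> V \<Longrightarrow>
       Y interior_of (\<pi> ` (X closure_of U) \<inter> \<pi> ` (X closure_of V)) \<noteq> {}"
    using ex_fat_pair[OF F _ F_image] by meson
  have "\<exists>J. infinite J \<and> indep_set X actX U V J"
    if UV: "openin X U" "a \<in> U" "openin X V" "b \<in> V" for U V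
  proof -
    \<comment> \<open>Shrinking to disjoint neighbourhoods meets the disjointness hypothesis of
      \<open>infinite_indep_set\<close>; \<open>indep_set_mono\<close> returns to \<open>U\<close>
      and \<open>V\<close>.\<close>
    obtain U0 V0 where UV0: "openin X U0" "openin X V0" "a \<in> U0" "b \<in> V0" "disjnt U0 V0"
      using X.Hausdorff ab unfolding Hausdorff_space_def by metis
    define U' where "U' = U \<inter> U0"
    define V' where "V' = V \<inter> V0"
    have UV': "openin X U'" "a \<in> U'" "openin X V'" "b \<in> V'" "U' \<inter> V' = {}"
      using UV UV0 by (auto simp: U'_def V'_def disjnt_def)
    define P where "P = Y interior_of (\<pi> ` (X closure_of U') \<inter> \<pi> ` (X closure_of V'))"
    \<comment> \<open>Over \<open>P\<close>, every fibre meets the closure of \<open>V'\<close>, so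
      \<open>U' \<inter> E\<close> can serve as the set \<open>N\<close> of
      \<open>infinite_indep_set\<close>.\<close>
    define E where "E = {x \<in> topspace X. \<pi> x \<in> P}"
    have P: "openin Y P" "P \<noteq> {}" "P \<subseteq> \<pi> ` (X closure_of U')" "P \<subseteq> \<pi> ` (X closure_of V')"
      unfolding P_def using fat[OF UV'(1-4)] 
      using interior_of_subset[of Y "\<pi> ` (X closure_of U') \<inter> \<pi> ` (X closure_of V')"] by auto
    have E: "openin X E" unfolding E_def by (rule openin_continuous_map_preimage[OF continuous P(1)])
    obtain p where "p \<in> P" using P(2) by blast
    then obtain c where c: "c \<in> X closure_of U'" "\<pi> c \<in> P" using P(3) by blast
    then have "c \<in> E" using closure_of_subset_topspace[of X U'] by (auto simp: E_def)
    then have "U' \<inter> E \<noteq> {}" using c(1) E unfolding in_closure_of by blast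
    moreover have "\<exists>w'\<in>X closure_of V'. X.eq_related w w'" if w: "w \<in> U' \<inter> E" for w
    proof -
      have "\<pi> w \<in> P" "w \<in> topspace X" using w by (auto simp: E_def)
      then obtain w' where w': "w' \<in> X closure_of V'" "\<pi> w' = \<pi> w" using P(4) by (metis imageE subsetD)
      then have "w' \<in> topspace X" using closure_of_subset_topspace[of X V'] by blast
      then have "(w, w') \<in> R_rel X \<pi>" using w'(2) \<open>w \<in> topspace X\<close> by (simp add: R_rel_def)
      then show ?thesis using rel w'(1) by blast
    qed
    ultimately obtain J where "infinite J" "indep_set X actX U' V' J"
      using X.infinite_indep_set[of "U' \<inter> E" U' V'] UV' E by auto
    then show ?thesis using indep_set_mono[of X actX U' V' J U V] by (auto simp: U'_def V'_def)
  qed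
  then have "(a, b) \<in> IT2 X actX" using ab by (auto simp: IT2_def)
  moreover have "(a, b) \<in> R_rel X \<pi>"
    using ab fat_pair_in_fibre[OF ab(1,2) fat] by (simp add: R_rel_def)
  ultimately show False using tame ab(3) by (auto simp: tame_ext_def Delta2_def)
qed

section \<open>The implications between the three conditions\<close>

text \<open>If a fibre lies in the translate by \<open>s\<close> of a small neighbourhood of
  \<open>x1\<close>, then \<open>- s\<close> squeezes the whole fibre into that neighbourhood, so
  the pair orbit accumulates at \<open>(x1, x1)\<close>.\<close>

lemma highly_proximal_imp_proximal:
  assumes "highly_proximal_ext X actX Y \<pi>"
  shows "proximal_ext X actX \<pi>"
  unfolding proximal_ext_def
proof clarify
  fix x1 x2 assume "(x1, x2) \<in> R_rel X \<pi>"
  then have x: "x1 \<in> topspace X" "x2 \<in> topspace X" "\<pi> x1 = \<pi> x2" by (auto simp: R_rel_def)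
  have "\<exists>y. y \<in> range (\<lambda>s. (actX s x1, actX s x2)) \<and> y \<in> T"
    if T: "(x1, x1) \<in> T" "openin (prod_topology X X) T" for T
  proof -
    obtain U V where UV: "openin X U" "openin X V" "x1 \<in> U" "x1 \<in> V" "U \<times> V \<subseteq> T"
      using T unfolding openin_prod_topology_alt by metis
    then have "openin X (U \<inter> V)" "U \<inter> V \<noteq> {}" by auto
    then obtain s where s: "{x \<in> topspace X. \<pi> x = \<pi> x1} \<subseteq> actX s ` (U \<inter> V)"
      using assms in_topspace[OF x(1)] unfolding highly_proximal_ext_def by metis
    have ret: "actX (- s) y \<in> U \<inter> V" if y: "y \<in> topspace X" "\<pi> y = \<pi> x1" for y
    proof -
      obtain u where u: "u \<in> U \<inter> V" "y = actX s u" using s y by blast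
      then have "u \<in> topspace X" using UV(1) openin_subset by blast
      then show ?thesis using u by simp
    qed
    then have "(actX (- s) x1, actX (- s) x2) \<in> T" using UV(5) ret x by auto
    then show ?thesis by blast
  qed
  then have "(x1, x1) \<in> (prod_topology X X) closure_of (range (\<lambda>s. (actX s x1, actX s x2)))"
    using x unfolding in_closure_of by simp
  moreover have "(x1, x1) \<in> Delta2 X" using x by (simp add: Delta2_def)
  ultimately show "proximal_pair X actX x1 x2" unfolding proximal_pair_def by blast
qed

text \<open>Equicontinuous systems have no proximal pairs off the diagonal: once the orbit of a pair
  enters \<open>D\<close>, applying \<open>- s\<close> brings back the original pair, which
  \<open>E\<close> was chosen to omit. Thus \<theta> is constant on fibres and descends along the
  quotient map \<pi>.\<close>

lemma proximal_imp_factors_through: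
  assumes prox: "proximal_ext X actX \<pi>"
  shows "eqc_factors_through TYPE('w) X actX Y actY \<pi>"
  unfolding eqc_factors_through_def
proof (intro allI impI, elim conjE)
  fix W :: "'w topology" and actW \<theta>
  assume W: "G_system W actW" "equicontinuous_system W actW" "extension X actX W actW \<theta>"
  have \<theta>: "continuous_map X W \<theta>" "\<theta> ` topspace X = topspace W"
    "\<And>s x. x \<in> topspace X \<Longrightarrow> \<theta> (actX s x) = actW s (\<theta> x)"
    using W(3) by (auto simp: extension_def)
  have "\<theta> x1 = \<theta> x2" if x: "x1 \<in> topspace X" "x2 \<in> topspace X" "\<pi> x1 = \<pi> x2" for x1 x2
  proof (rule ccontr)
    assume ne: "\<theta> x1 \<noteq> \<theta> x2"
    define E where "E = topspace (prod_topology W W) - {(\<theta> x1, \<theta> x2)}"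
    have \<theta>x: "\<theta> x1 \<in> topspace W" "\<theta> x2 \<in> topspace W" using \<theta>(2) x by auto
    have "Hausdorff_space (prod_topology W W)" using W(1) by (simp add: G_system_def Hausdorff_space_prod_topology)
    then have "closedin (prod_topology W W) {(\<theta> x1, \<theta> x2)}"
      using \<theta>x by (intro closedin_Hausdorff_singleton) auto
    then have "openin (prod_topology W W) E" unfolding E_def by (rule openin_diff[OF openin_topspace])
    moreover have "Delta2 W \<subseteq> E" using ne by (auto simp: E_def Delta2_def)
    ultimately obtain D where D: "openin (prod_topology W W) D" "Delta2 W \<subseteq> D"
      "\<And>s w1 w2. (w1, w2) \<in> D \<Longrightarrow> (actW s w1, actW s w2) \<in> E"
      using W(2)[unfolded equicontinuous_system_def, rule_format, of E] by fast
    have "(x1, x2) \<in> R_rel X \<pi>" using x by (simp add: R_rel_def)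
    then have "proximal_pair X actX x1 x2" using prox unfolding proximal_ext_def by blast
    then obtain c where c: "c \<in> topspace X"
      "(c, c) \<in> (prod_topology X X) closure_of (range (\<lambda>s. (actX s x1, actX s x2)))"
      by (auto simp: proximal_pair_def Delta2_def)
    define D' where "D' = {p \<in> topspace (prod_topology X X). (\<theta> (fst p), \<theta> (snd p)) \<in> D}"
    have "continuous_map (prod_topology X X) (prod_topology W W) (\<lambda>p. (\<theta> (fst p), \<theta> (snd p)))"
      using continuous_map_compose[OF continuous_map_fst[of X X] \<theta>(1)]
        continuous_map_compose[OF continuous_map_snd[of X X] \<theta>(1)]
      by (simp add: continuous_map_paired o_def)
    then have "openin (prod_topology X X) D'"
      unfolding D'_def by (rule openin_continuous_map_preimage[OF _ D(1)])
    moreover have "(c, c) \<in> D'"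
      using c(1) \<theta>(2) D(2) by (auto simp: D'_def Delta2_def)
    ultimately obtain s where "(actX s x1, actX s x2) \<in> D'" using c(2) unfolding in_closure_of by blast
    then have "(\<theta> (actX s x1), \<theta> (actX s x2)) \<in> D" by (simp add: D'_def)
    from D(3)[OF this, of "- s"] have "(\<theta> (actX (- s) (actX s x1)), \<theta> (actX (- s) (actX s x2))) \<in> E"
      using x by (simp only: \<theta>(3) X.act_in)
    then show False using x by (simp add: E_def)
  qed
  moreover have "quotient_map X Y \<pi>"
    using continuous X.compact Y.Hausdorff surj by (rule continuous_imp_quotient_map)
  ultimately obtain \<theta>' where \<theta>': "continuous_map Y W \<theta>'" "\<theta>' ` topspace Y = \<theta> ` topspace X"
    "\<And>x. x \<in> topspace X \<Longrightarrow> \<theta>' (\<pi> x) = \<theta> x"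
    using quotient_map_lift_exists[of X Y \<pi> W \<theta>] \<theta>(1) by metis
  have "\<theta>' (actY s y) = actW s (\<theta>' y)" if y: "y \<in> topspace Y" for s y
  proof -
    obtain x where "x \<in> topspace X" "y = \<pi> x" using y surj by blast
    then show ?thesis by (simp add: \<theta>'(3) \<theta>(3) flip: equivariant)
  qed
  then have "extension Y actY W actW \<theta>'" using \<theta>' \<theta>(2) by (simp add: extension_def)
  then show "\<exists>\<theta>'. extension Y actY W actW \<theta>' \<and> (\<forall>x\<in>topspace X. \<theta> x = \<theta>' (\<pi> x))"
    using \<theta>'(3) by metis
qed

lemma factors_through_imp_highly_proximal:
  assumes "tame_ext X actX \<pi>" "eqc_factors_through TYPE('a set) X actX Y actY \<pi>"
  shows "highly_proximal_ext X actX Y \<pi>"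
proof (rule highly_proximal_if_eq_related[OF assms(1)])
  fix x y assume "(x, y) \<in> R_rel X \<pi>"
  then show "X.eq_related x y"
    using X.factors_through_imp_pseudometric_eq_0[OF assms(2)]
    by (simp add: X.eq_related_def R_rel_def)
qed

end

text \<open>Condition (3) ranges over factors carried by one type: (2) yields it for any
  \<open>'w\<close>, while the converse uses it at \<open>'a set\<close>, where the pseudometric
  quotient lives. Both the converse and the last clause pass through (3) to (1).\<close>

theorem theorem7p14:
  fixes X :: "'a topology" and Y :: "'b topology"
    and actX :: "'g::topological_ab_group_add \<Rightarrow> 'a \<Rightarrow> 'a"
    and actY :: "'g \<Rightarrow> 'b \<Rightarrow> 'b"
    and \<pi> :: "'a \<Rightarrow> 'b"
  assumes "minimal_system X actX" and "minimal_system Y actY"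
    and "extension X actX Y actY \<pi>"
    and "tame_ext X actX \<pi>"
  shows "(highly_proximal_ext X actX Y \<pi> \<longrightarrow> proximal_ext X actX \<pi>)
    \<and> (proximal_ext X actX \<pi> \<longrightarrow> eqc_factors_through TYPE('w) X actX Y actY \<pi>)
    \<and> (eqc_factors_through TYPE('a set) X actX Y actY \<pi> \<longrightarrow> proximal_ext X actX \<pi>)
    \<and> (metrizable_space X \<or> (open_map X Y \<pi> \<and> metrizable_space Y) \<longrightarrow>
         (proximal_ext X actX \<pi> \<longrightarrow> highly_proximal_ext X actX Y \<pi>))"
proof -
  interpret minimal_extension X actX Y actY \<pi>
    by unfold_locales (use assms in auto)
  have "eqc_factors_through TYPE('a set) X actX Y actY \<pi> \<Longrightarrow> highly_proximal_ext X actX Y \<pi>"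
    by (rule factors_through_imp_highly_proximal[OF assms(4)])
  then show ?thesis
    using highly_proximal_imp_proximal proximal_imp_factors_through[where 'w = 'w]
      proximal_imp_factors_through[where 'w = "'a set"] by metis
qed

end
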